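(* Let $0<p_n<n$ with $p_n=o(n)$, and let $\tau=\tau_n>0$ satisfy $(p_n/n)^K\lesssim\tau\lesssim\frac{p_n}{n}(\log(n/p_n))^{-1/2}$ for some constant $K>1$. Consider the horseshoe+ prior: independently for $i=1,\dots,n$, $$\theta_i\mid\sigma_i\sim\mathcal N(0,\sigma_i^2),\qquad \sigma_i\mid\eta_i\sim C^+(0,\tau\eta_i),\qquad \eta_i\sim C^+(0,1),$$ i.e. the scale-mixture-of-normals prior whose mixing density for $\sigma_i^2$ is $$\pi(u)=\frac{\tau}{\boldsymbol\pi^2}\,\frac{\log(u/\tau^2)}{(u-\tau^2)\,u^{1/2}},\quad u>0,$$ where $\boldsymbol\pi=3.14\ldots$. Then for every positive sequence $M_n\to\infty$, $$\sup_{\theta_0\in\ell_0[p_n]}\mathbb E_{\theta_0}\Pi\big(\theta:\|\theta-\theta_0\|^2>M_np_n\log(n/p_n)\,\big|\,X^n\big)\to0 \quad\text{and}\quad \sup_{\theta_0\in\ell_0[p_n]}\mathbb E_{\theta_0}\|\widehat\theta-\theta_0\|^2\lesssim p_n\log(n/p_n).$$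
   Context: $C^+(0,\lambda)$ is the half-Cauchy distribution: the law of a Cauchy random variable with location $0$ and scale $\lambda$ conditioned to be positive. Model: for each $n$, $X^n=(X_1,\dots,X_n)\sim\mathcal N(\theta_0,I_n)$ with $\theta_0\in\mathbb R^n$; $\mathbb E_{\theta_0}$ is expectation under this law. $\ell_0[p_n]=\{\theta\in\mathbb R^n:\sum_{i=1}^n\mathbf 1\{\theta_i\ne0\}\le p_n\}$. The scale-mixture-of-normals prior with mixing density $\pi$ (a possibly $n$-dependent probability density on $[0,\infty)$): independently for $i=1,\dots,n$, $\theta_i\mid\sigma_i^2\sim\mathcal N(0,\sigma_i^2)$ and $\sigma_i^2\sim\pi$. $\Pi(\cdot\mid X^n)$ is the posterior distribution of $\theta=(\theta_1,\dots,\theta_n)$ when $X^n\mid\theta\sim\mathcal N(\theta,I_n)$, and $\widehat\theta$ is the coordinatewise posterior mean. $\|\cdot\|$ is the Euclidean norm. Limits are as $n\to\infty$; $A_n\lesssim B_n$ means $A_n\le C_0B_n$ for all sufficiently large $n$ with a constant $C_0$ independent of $n$. *)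

theory Defs
  imports "HOL-Probability.Probability"
begin

text \<open>Points of \<open>n\<close>-dimensional Euclidean space are functions in \<open>{1..n} \<rightarrow>\<^sub>E UNIV\<close>, and the
  Euclidean norm is \<open>L2_set\<close>.\<close>

definition euclidean_points :: "nat \<Rightarrow> (nat \<Rightarrow> real) set" where
  "euclidean_points n = {1..n} \<rightarrow>\<^sub>E UNIV"

definition sparse_vectors :: "nat \<Rightarrow> real \<Rightarrow> (nat \<Rightarrow> real) set" where
  "sparse_vectors n p =
     {\<theta> \<in> euclidean_points n. (\<Sum>i=1..n. of_bool (\<theta> i \<noteq> 0)) \<le> p}"

text \<open>For a standard deviation \<open>\<sigma> = 0\<close> this is the null measure rather than a point mass; the scale
  distributions below have Lebesgue densities and give \<open>0\<close> no mass.\<close>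

definition normal_law :: "real \<Rightarrow> real \<Rightarrow> real measure" where
  "normal_law \<mu> \<sigma> = density lborel (\<lambda>x. ennreal (normal_density \<mu> \<sigma> x))"

definition cauchy_density :: "real \<Rightarrow> real \<Rightarrow> real \<Rightarrow> real" where
  "cauchy_density m s x = 1 / (pi * s * (1 + ((x - m) / s)\<^sup>2))"

text \<open>A Cauchy law needs a scale \<open>s > 0\<close>; for \<open>s \<le> 0\<close> the following two are null measures. This
  keeps them subprobability kernels in \<open>s\<close>, as monadic bind requires.\<close>

definition cauchy_law :: "real \<Rightarrow> real \<Rightarrow> real measure" where
  "cauchy_law m s = density lborel (\<lambda>x. ennreal (cauchy_density m s x))"

definition half_cauchy :: "real \<Rightarrow> real measure" where
  "half_cauchy s = uniform_measure (cauchy_law 0 s) {0<..}"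

definition horseshoe_plus_scale :: "real \<Rightarrow> real measure" where
  "horseshoe_plus_scale \<tau> = half_cauchy 1 \<bind> (\<lambda>\<eta>. half_cauchy (\<tau> * \<eta>))"

definition horseshoe_plus :: "real \<Rightarrow> real measure" where
  "horseshoe_plus \<tau> = horseshoe_plus_scale \<tau> \<bind> (\<lambda>\<sigma>. normal_law 0 \<sigma>)"

text \<open>At the single point \<open>u = \<tau>\<^sup>2\<close> division by zero makes this \<open>0\<close> instead of the limiting value.\<close>

definition horseshoe_plus_mixing_density :: "real \<Rightarrow> real \<Rightarrow> real" where
  "horseshoe_plus_mixing_density \<tau> u =
     (if u > 0 then \<tau> / pi\<^sup>2 * (ln (u / \<tau>\<^sup>2) / ((u - \<tau>\<^sup>2) * u powr (1/2))) else 0)"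

definition iid_prior :: "nat \<Rightarrow> real measure \<Rightarrow> (nat \<Rightarrow> real) measure" where
  "iid_prior n \<nu> = Pi\<^sub>M {1..n} (\<lambda>_. \<nu>)"

definition sample_law :: "nat \<Rightarrow> (nat \<Rightarrow> real) \<Rightarrow> (nat \<Rightarrow> real) measure" where
  "sample_law n \<theta> = Pi\<^sub>M {1..n} (\<lambda>i. normal_law (\<theta> i) 1)"

definition likelihood :: "nat \<Rightarrow> (nat \<Rightarrow> real) \<Rightarrow> (nat \<Rightarrow> real) \<Rightarrow> real" where
  "likelihood n \<theta> x = (\<Prod>i=1..n. normal_density (\<theta> i) 1 (x i))"

text \<open>Bayes' formula for the dominated family \<open>sample_law n \<theta>\<close>.\<close>

definition posterior ::
  "nat \<Rightarrow> (nat \<Rightarrow> real) measure \<Rightarrow> (nat \<Rightarrow> real) \<Rightarrow> (nat \<Rightarrow> real) measure" where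
  "posterior n P x =
     density P (\<lambda>\<theta>. ennreal (likelihood n \<theta> x) / (\<integral>\<^sup>+\<theta>'. ennreal (likelihood n \<theta>' x) \<partial>P))"

definition posterior_mean ::
  "nat \<Rightarrow> (nat \<Rightarrow> real) measure \<Rightarrow> (nat \<Rightarrow> real) \<Rightarrow> nat \<Rightarrow> real" where
  "posterior_mean n P x = (\<lambda>i\<in>{1..n}. \<integral>\<theta>. \<theta> i \<partial>posterior n P x)"

definition sq_dist :: "nat \<Rightarrow> (nat \<Rightarrow> real) \<Rightarrow> (nat \<Rightarrow> real) \<Rightarrow> real" where
  "sq_dist n \<theta> \<theta>' = (L2_set (\<lambda>i. \<theta> i - \<theta>' i) {1..n})\<^sup>2"

end

theory Submission
  imports Defs
begin

text \<open>
  Why the theorem holds. Under a product prior the posterior factorises, so the posterior expectation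
  of \<open>sq_dist n \<theta> \<theta>\<^sub>0\<close> is a sum of one-dimensional ratios \<open>weighted_error \<nu> a x / evidence \<nu> x\<close>
  (lemma \<open>posterior_error\<close>). Markov's inequality bounds the posterior tail by this sum, and Jensen's
  inequality bounds the error of the posterior mean by it. Both asymptotic claims therefore follow from
  one bound \<open>C p log(n/p)\<close> on the expectation of the sum. With \<open>s = p/n\<close> and \<open>L = log(n/p)\<close>, it suffices
  that a coordinate with \<open>a = 0\<close> (noise) has risk of order \<open>s L\<close>, and that any coordinate
  has risk of order \<open>L\<close>, which is used at most \<open>p\<close> times, for the signals.

  Given the scale \<open>\<sigma>\<close>, the posterior is \<open>N(\<kappa> x, \<kappa>)\<close> with shrinkage factor \<open>\<kappa> = \<sigma>\<^sup>2/(1+\<sigma>\<^sup>2)\<close>, and \<open>x\<close> has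
  marginal law \<open>N(0, 1+\<sigma>\<^sup>2)\<close>; so numerator and denominator of the ratio are integrals over the law of \<open>\<sigma>\<close>.

  Signals. The error beyond a constant is the bias \<open>(1-\<kappa>) x = x/(1+\<sigma>\<^sup>2)\<close>. It is at most of order \<open>sqrt L\<close> when
  \<open>|x|\<close> is. For larger \<open>|x|\<close>, scales with \<open>|x|/(1+\<sigma>\<^sup>2) > sqrt L\<close> have marginal density at
  most \<open>exp(-|x| sqrt L / 2)\<close>, whereas the heavy tail of the prior keeps the evidence above a multiple of
  \<open>\<tau>/x\<^sup>2\<close>. As \<open>\<tau>\<close> is at least of order \<open>s\<^sup>K = exp(-K L)\<close>, the former is negligible
  (lemma \<open>shrinkage_bias_le\<close>).

  Noise. As \<open>\<tau> \<le> 1\<close> for large \<open>n\<close>, the prior puts mass at least \<open>1/4\<close> on \<open>\<sigma> \<le> 1\<close>, so the evidence dominates a multiple of the standard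
  normal density \<open>\<phi>\<close>, and \<open>\<phi> * weighted_error / evidence\<close> is at most a constant times \<open>weighted_error\<close>.
  On \<open>|x| \<le> t\<close> with \<open>t\<^sup>2 = 4 L\<close>, exchanging the integrals leaves \<open>E min(\<sigma>\<^sup>2, 1+t\<^sup>2)\<close>. A half-Cauchy law with
  scale \<open>q\<close> has density at most of order \<open>q/\<sigma>\<^sup>2\<close>, so this is of order \<open>\<tau> t log(t/\<tau>)\<close>, that is \<open>\<tau> L\<close> times \<open>sqrt L\<close>
  (lemma \<open>horseshoe_plus_scale_truncated_second_moment\<close>); the factor \<open>L\<^sup>-\<^sup>1\<^sup>/\<^sup>2\<close> in the upper bound on
  \<open>\<tau>\<close> turns it into \<open>s L\<close>. On \<open>|x| > t\<close> a trivial bound and the Gaussian tail give \<open>exp(-t\<^sup>2/4) = s\<close>.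

  The formula for the mixing density is a partial fraction integral over \<open>\<eta>\<close>, followed by the substitution \<open>u = \<sigma>\<^sup>2\<close>.
\<close>

section \<open>Half-Cauchy laws and the mixing density\<close>

text \<open>The value \<open>0\<close> for \<open>q \<le> 0\<close> makes \<open>half_cauchy_eq_density\<close> an identity in all \<open>q\<close>, so that the scale may be integrated over the whole line.\<close>
definition half_cauchy_density :: "real \<Rightarrow> real \<Rightarrow> real" where
  "half_cauchy_density q x = (if 0 < q \<and> 0 < x then 2 * q / (pi * (q\<^sup>2 + x\<^sup>2)) else 0)"

lemma half_cauchy_density_nonneg [simp]: "0 \<le> half_cauchy_density q x"
  by (simp add: half_cauchy_density_def)

lemma borel_measurable_half_cauchy_density [measurable (raw)]:
  assumes "f \<in> borel_measurable M" "g \<in> borel_measurable M"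
  shows "(\<lambda>x. half_cauchy_density (f x) (g x)) \<in> borel_measurable M"
  using assms unfolding half_cauchy_density_def by measurable

lemma arctan_scaled_derivative:
  fixes q :: real
  assumes "q > 0"
  shows "((\<lambda>x. 2 * arctan (x / q) / pi) has_real_derivative 2 * q / (pi * (q\<^sup>2 + x\<^sup>2))) (at x)"
proof -
  have "inverse (1 + (x / q)\<^sup>2) = q\<^sup>2 / (q\<^sup>2 + x\<^sup>2)"
    using assms by (simp add: field_simps power2_eq_square)
  moreover have "q\<^sup>2 + x\<^sup>2 > 0"
    using assms by (simp add: add_pos_nonneg)
  ultimately show ?thesis
    using assms by (auto intro!: derivative_eq_intros simp: divide_simps) (simp_all add: power2_eq_square)
qed

lemma nn_integral_half_cauchy_density:
  assumes "q > 0"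
  shows "(\<integral>\<^sup>+x. half_cauchy_density q x \<partial>lborel) = 1"
proof -
  have "(\<integral>\<^sup>+x. half_cauchy_density q x \<partial>lborel)
      = (\<integral>\<^sup>+x. ennreal (2 * q / (pi * (q\<^sup>2 + x\<^sup>2))) * indicator {0..} x \<partial>lborel)"
    using assms AE_lborel_singleton[of "0::real"]
    by (intro nn_integral_cong_AE)
       (auto elim!: eventually_mono simp: half_cauchy_density_def split: split_indicator)
  also have "\<dots> = ennreal (1 - 2 * arctan (0 / q) / pi)"
  proof (rule nn_integral_FTC_atLeast)
    have scaled: "filterlim (\<lambda>x. x / q) at_top at_top"
      using filterlim_tendsto_pos_mult_at_top[OF tendsto_const[of "1 / q"] _ filterlim_ident] assms
      by simp
    have "((\<lambda>x. 2 * arctan (x / q) / pi) \<longlongrightarrow> 2 * (pi / 2) / pi) at_top"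
      using assms
      by (intro tendsto_intros filterlim_compose[OF tendsto_arctan_at_top] scaled) simp_all
    then show "((\<lambda>x. 2 * arctan (x / q) / pi) \<longlongrightarrow> 1) at_top" by simp
  qed (use assms in \<open>auto intro!: arctan_scaled_derivative\<close>)
  finally show ?thesis by simp
qed

lemma half_cauchy_eq_density: "half_cauchy q = density lborel (half_cauchy_density q)"
proof (cases "q > 0")
  case False
  then have "cauchy_law 0 q = density lborel (\<lambda>_. 0)"
    unfolding cauchy_law_def cauchy_density_def
    by (intro density_cong AE_I2 ennreal_neg)
       (auto simp: divide_le_0_iff mult_le_0_iff add_nonneg_nonneg)
  then show ?thesis
    using False by (simp add: half_cauchy_def uniform_measure_def density_density_eq half_cauchy_density_def)
next
  case True
  have dens: "ennreal (cauchy_density 0 q x) * indicator {0<..} x = ennreal (half_cauchy_density q x) / 2" for x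
  proof -
    have "q\<^sup>2 + x\<^sup>2 > 0" using True by (simp add: add_pos_nonneg)
    then have "cauchy_density 0 q x = q / (pi * (q\<^sup>2 + x\<^sup>2))"
      using True by (simp add: cauchy_density_def divide_simps) (simp add: algebra_simps power2_eq_square)
    then show ?thesis
      using True divide_ennreal[of "half_cauchy_density q x" 2]
      by (auto simp: half_cauchy_density_def split: split_indicator)
  qed
  have [measurable]: "cauchy_density 0 q \<in> borel_measurable borel"
    unfolding cauchy_density_def by measurable
  have mass: "emeasure (cauchy_law 0 q) {0<..} = 1 / 2"
    unfolding cauchy_law_def using True
    by (subst emeasure_density)
       (simp_all add: dens nn_integral_divide nn_integral_half_cauchy_density)
  have halves: "ennreal r / 2 / (1 / 2) = ennreal r" if "r \<ge> 0" for r
    using that divide_ennreal[of r 2] divide_ennreal[of 1 2] divide_ennreal[of "r / 2" "1 / 2"] by simp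
  have "indicator {0<..} x / (1 / 2 :: ennreal) * ennreal (cauchy_density 0 q x) = ennreal (half_cauchy_density q x)" for x
  proof -
    have "indicator {0<..} x / (1 / 2 :: ennreal) * ennreal (cauchy_density 0 q x)
        = ennreal (cauchy_density 0 q x) * indicator {0<..} x / (1 / 2)"
      by (simp add: ennreal_times_divide mult.commute)
    then show ?thesis
      by (simp add: dens halves)
  qed
  then show ?thesis
    unfolding half_cauchy_def uniform_measure_def mass unfolding cauchy_law_def
    by (subst density_density_eq) (auto intro!: density_cong simp: mult.commute)
qed

lemma sets_half_cauchy [simp, measurable_cong]: "sets (half_cauchy q) = sets borel"
  by (simp add: half_cauchy_eq_density)

lemma space_half_cauchy [simp]: "space (half_cauchy q) = UNIV"
  by (simp add: half_cauchy_eq_density)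

lemma nn_integral_half_cauchy:
  fixes f :: "real \<Rightarrow> ennreal"
  assumes [measurable]: "f \<in> borel_measurable borel"
  shows "(\<integral>\<^sup>+x. f x \<partial>half_cauchy q) = (\<integral>\<^sup>+x. half_cauchy_density q x * f x \<partial>lborel)"
  unfolding half_cauchy_eq_density by (subst nn_integral_density) auto

lemma emeasure_half_cauchy_UNIV: "emeasure (half_cauchy q) UNIV = of_bool (q > 0)"
proof (cases "q > 0")
  case True
  then show ?thesis
    unfolding half_cauchy_eq_density
    by (subst emeasure_density) (auto simp: nn_integral_half_cauchy_density)
next
  case False
  then show ?thesis
    unfolding half_cauchy_eq_density
    by (subst emeasure_density) (auto simp: half_cauchy_density_def)
qed

lemma measurable_half_cauchy [measurable]: "half_cauchy \<in> borel \<rightarrow>\<^sub>M subprob_algebra borel"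
proof (rule measurable_subprob_algebra)
  show "subprob_space (half_cauchy q)" for q
    by (rule subprob_spaceI) (simp_all add: emeasure_half_cauchy_UNIV)
next
  fix A :: "real set" assume [measurable]: "A \<in> sets borel"
  have "emeasure (half_cauchy q) A = (\<integral>\<^sup>+x. ennreal (half_cauchy_density q x) * indicator A x \<partial>lborel)" for q
    unfolding half_cauchy_eq_density by (subst emeasure_density) auto
  then show "(\<lambda>q. emeasure (half_cauchy q) A) \<in> borel_measurable borel"
    by simp
qed simp

lemma sets_horseshoe_plus_scale [simp, measurable_cong]:
  "sets (horseshoe_plus_scale \<tau>) = sets borel"
  unfolding horseshoe_plus_scale_def by (subst sets_bind) simp_all

lemma space_horseshoe_plus_scale [simp]: "space (horseshoe_plus_scale \<tau>) = UNIV"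
  using sets_eq_imp_space_eq[OF sets_horseshoe_plus_scale[of \<tau>]] by simp

lemma nn_integral_horseshoe_plus_scale:
  fixes f :: "real \<Rightarrow> ennreal"
  assumes [measurable]: "f \<in> borel_measurable borel"
  shows "(\<integral>\<^sup>+\<sigma>. f \<sigma> \<partial>horseshoe_plus_scale \<tau>)
    = (\<integral>\<^sup>+\<eta>. half_cauchy_density 1 \<eta> * (\<integral>\<^sup>+\<sigma>. half_cauchy_density (\<tau> * \<eta>) \<sigma> * f \<sigma> \<partial>lborel) \<partial>lborel)"
proof -
  have "(\<integral>\<^sup>+\<sigma>. f \<sigma> \<partial>horseshoe_plus_scale \<tau>)
      = (\<integral>\<^sup>+\<eta>. (\<integral>\<^sup>+\<sigma>. f \<sigma> \<partial>half_cauchy (\<tau> * \<eta>)) \<partial>half_cauchy 1)"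
    unfolding horseshoe_plus_scale_def by (rule nn_integral_bind[where B = borel]) measurable
  also have "\<dots> = (\<integral>\<^sup>+\<eta>. half_cauchy_density 1 \<eta> * (\<integral>\<^sup>+\<sigma>. f \<sigma> \<partial>half_cauchy (\<tau> * \<eta>)) \<partial>lborel)"
    by (subst nn_integral_half_cauchy) (auto simp: nn_integral_half_cauchy)
  finally show ?thesis by (simp add: nn_integral_half_cauchy)
qed

lemma prob_space_horseshoe_plus_scale:
  assumes "\<tau> > 0"
  shows "prob_space (horseshoe_plus_scale \<tau>)"
proof
  have "emeasure (horseshoe_plus_scale \<tau>) UNIV = (\<integral>\<^sup>+\<sigma>. 1 \<partial>horseshoe_plus_scale \<tau>)"
    by simp
  also have "\<dots> = (\<integral>\<^sup>+\<eta>. half_cauchy_density 1 \<eta> \<partial>lborel)"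
    using assms by (subst nn_integral_horseshoe_plus_scale) (auto intro!: nn_integral_cong simp: half_cauchy_density_def[of 1] nn_integral_half_cauchy_density)
  also have "\<dots> = 1"
    by (simp add: nn_integral_half_cauchy_density)
  finally show "emeasure (horseshoe_plus_scale \<tau>) (space (horseshoe_plus_scale \<tau>)) = 1" by simp
qed

lemma AE_horseshoe_plus_scale_pos: "AE \<sigma> in horseshoe_plus_scale \<tau>. \<sigma> > 0"
proof (rule AE_I)
  have "emeasure (horseshoe_plus_scale \<tau>) {..0} = (\<integral>\<^sup>+\<sigma>. indicator {..0} \<sigma> \<partial>horseshoe_plus_scale \<tau>)"
    by simp
  also have "\<dots> = 0"
  proof -
    have "ennreal (half_cauchy_density q \<sigma>) * indicator {..0} \<sigma> = 0" for q \<sigma>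
      by (auto simp: half_cauchy_density_def split: split_indicator)
    then show ?thesis
      by (subst nn_integral_horseshoe_plus_scale) (simp_all del: mult_eq_0_iff ennreal_eq_0_iff)
  qed
  finally show "emeasure (horseshoe_plus_scale \<tau>) {..0} = 0" by simp
qed auto

text \<open>By partial fractions the integrand in \<open>\<eta>\<close> is a multiple of \<open>\<eta>/(1+\<eta>\<^sup>2) - \<tau>\<^sup>2 \<eta>/(\<tau>\<^sup>2 \<eta>\<^sup>2 + \<sigma>\<^sup>2)\<close>,
  which integrates to a difference of logarithms. At \<open>\<sigma> = \<tau>\<close> the decomposition breaks down; a single point
  does not matter for a density.\<close>
lemma half_cauchy_mixture_density:
  assumes \<tau>: "\<tau> > 0" and \<sigma>: "\<sigma> > 0" "\<sigma> \<noteq> \<tau>"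
  shows "(\<integral>\<^sup>+\<eta>. ennreal (half_cauchy_density 1 \<eta>) * ennreal (half_cauchy_density (\<tau> * \<eta>) \<sigma>) \<partial>lborel)
    = ennreal (2 * \<tau> / pi\<^sup>2 * ln (\<sigma>\<^sup>2 / \<tau>\<^sup>2) / (\<sigma>\<^sup>2 - \<tau>\<^sup>2))"
proof -
  define d where "d = \<sigma>\<^sup>2 - \<tau>\<^sup>2"
  have d: "d \<noteq> 0"
    using assms by (simp add: d_def power2_eq_iff_nonneg)
  define f where "f \<eta> = 4 * \<tau> * \<eta> / (pi\<^sup>2 * (1 + \<eta>\<^sup>2) * (\<tau>\<^sup>2 * \<eta>\<^sup>2 + \<sigma>\<^sup>2))" for \<eta>
  \<comment> \<open>the antiderivative of \<open>f\<close> given by the partial fraction decomposition\<close>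
  define F where "F \<eta> = 2 * \<tau> / pi\<^sup>2 / d * (ln (1 + \<eta>\<^sup>2) - ln (\<tau>\<^sup>2 * \<eta>\<^sup>2 + \<sigma>\<^sup>2))" for \<eta>
  have pos: "1 + \<eta>\<^sup>2 > 0" "\<tau>\<^sup>2 * \<eta>\<^sup>2 + \<sigma>\<^sup>2 > 0" for \<eta> :: real
    using \<sigma> by (simp_all add: add_pos_nonneg add_nonneg_pos)
  have "(\<integral>\<^sup>+\<eta>. ennreal (half_cauchy_density 1 \<eta>) * ennreal (half_cauchy_density (\<tau> * \<eta>) \<sigma>) \<partial>lborel)
      = (\<integral>\<^sup>+\<eta>. ennreal (f \<eta>) * indicator {0..} \<eta> \<partial>lborel)"
    using assms
    by (intro nn_integral_cong)
       (auto simp: half_cauchy_density_def f_def ennreal_mult[symmetric] power_mult_distrib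
          field_simps power2_eq_square split: split_indicator)
  also have "\<dots> = ennreal (2 * \<tau> / pi\<^sup>2 / d * ln (1 / \<tau>\<^sup>2) - F 0)"
  proof (rule nn_integral_FTC_atLeast)
    show "f \<in> borel_measurable borel" unfolding f_def by measurable
    show "0 \<le> f \<eta>" if "0 \<le> \<eta>" for \<eta>
      unfolding f_def using that \<tau> by (intro divide_nonneg_nonneg mult_nonneg_nonneg add_nonneg_nonneg) auto
    show "(F has_real_derivative f \<eta>) (at \<eta>)" if "0 \<le> \<eta>" for \<eta>
    proof -
      have frac: "2 * \<tau> / pi\<^sup>2 / d * (2 * \<eta> / (1 + \<eta>\<^sup>2) - \<tau>\<^sup>2 * (2 * \<eta>) / (\<tau>\<^sup>2 * \<eta>\<^sup>2 + \<sigma>\<^sup>2)) = f \<eta>"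
      proof -
        have "2 * \<eta> / (1 + \<eta>\<^sup>2) - \<tau>\<^sup>2 * (2 * \<eta>) / (\<tau>\<^sup>2 * \<eta>\<^sup>2 + \<sigma>\<^sup>2)
            = 2 * \<eta> * d / ((1 + \<eta>\<^sup>2) * (\<tau>\<^sup>2 * \<eta>\<^sup>2 + \<sigma>\<^sup>2))"
          using pos[of \<eta>] by (simp add: divide_simps d_def) (simp add: algebra_simps)
        then show ?thesis
          using d by (simp add: f_def)
      qed
      have "((\<lambda>\<eta>. ln (1 + \<eta>\<^sup>2) - ln (\<tau>\<^sup>2 * \<eta>\<^sup>2 + \<sigma>\<^sup>2)) has_real_derivative
          2 * \<eta> / (1 + \<eta>\<^sup>2) - \<tau>\<^sup>2 * (2 * \<eta>) / (\<tau>\<^sup>2 * \<eta>\<^sup>2 + \<sigma>\<^sup>2)) (at \<eta>)"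
        using pos[of \<eta>] by (auto intro!: derivative_eq_intros)
      from DERIV_cmult[OF this] show ?thesis
        unfolding F_def frac[symmetric] .
    qed
    have eq: "ln (1 + \<eta>\<^sup>2) - ln (\<tau>\<^sup>2 * \<eta>\<^sup>2 + \<sigma>\<^sup>2)
        = ln (1 / \<tau>\<^sup>2 + (1 - \<sigma>\<^sup>2 / \<tau>\<^sup>2) / (\<tau>\<^sup>2 * \<eta>\<^sup>2 + \<sigma>\<^sup>2))" for \<eta>
    proof -
      have "1 / \<tau>\<^sup>2 + (1 - \<sigma>\<^sup>2 / \<tau>\<^sup>2) / (\<tau>\<^sup>2 * \<eta>\<^sup>2 + \<sigma>\<^sup>2) = (1 + \<eta>\<^sup>2) / (\<tau>\<^sup>2 * \<eta>\<^sup>2 + \<sigma>\<^sup>2)"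
        using pos[of \<eta>] \<tau> by (simp add: divide_simps) (simp add: algebra_simps)
      then show ?thesis
        using pos[of \<eta>] by (simp add: ln_div)
    qed
    have "filterlim (\<lambda>\<eta>. \<tau>\<^sup>2 * \<eta>\<^sup>2) at_top at_top"
      using \<tau> by (intro filterlim_tendsto_pos_mult_at_top[OF tendsto_const] filterlim_pow_at_top filterlim_ident) auto
    then have "filterlim (\<lambda>\<eta>. \<tau>\<^sup>2 * \<eta>\<^sup>2 + \<sigma>\<^sup>2) at_top at_top"
      by (rule filterlim_at_top_add_at_top[OF _ ] filterlim_tendsto_add_at_top[OF tendsto_const, of _ _ "\<sigma>\<^sup>2", simplified add.commute])
    then have "((\<lambda>\<eta>. (1 - \<sigma>\<^sup>2 / \<tau>\<^sup>2) / (\<tau>\<^sup>2 * \<eta>\<^sup>2 + \<sigma>\<^sup>2)) \<longlongrightarrow> 0) at_top"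
      by (intro tendsto_divide_0[OF tendsto_const] filterlim_at_top_imp_at_infinity)
    then have "((\<lambda>\<eta>. ln (1 / \<tau>\<^sup>2 + (1 - \<sigma>\<^sup>2 / \<tau>\<^sup>2) / (\<tau>\<^sup>2 * \<eta>\<^sup>2 + \<sigma>\<^sup>2))) \<longlongrightarrow> ln (1 / \<tau>\<^sup>2 + 0)) at_top"
      using \<tau> by (intro tendsto_intros) auto
    then show "(F \<longlongrightarrow> 2 * \<tau> / pi\<^sup>2 / d * ln (1 / \<tau>\<^sup>2)) at_top"
      unfolding F_def eq by (intro tendsto_mult[OF tendsto_const]) simp
  qed
  also have "2 * \<tau> / pi\<^sup>2 / d * ln (1 / \<tau>\<^sup>2) - F 0 = 2 * \<tau> / pi\<^sup>2 * ln (\<sigma>\<^sup>2 / \<tau>\<^sup>2) / d"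
    using assms d by (simp add: F_def ln_div field_simps)
  finally show ?thesis by (simp add: d_def)
qed

lemma SUP_mult_indicator:
  fixes c :: ennreal
  shows "(SUP n. c * indicator (S n) x) = c * indicator (\<Union>n. S n) x"
proof (cases "x \<in> (\<Union>n. S n)")
  case True
  then obtain n where "x \<in> S n" by auto
  then show ?thesis
    using True by (intro antisym SUP_least SUP_upper2[of n]) (auto split: split_indicator)
qed auto

text \<open>The substitution rule for compact intervals applies on \<open>{0..n}\<close>; monotone convergence removes the cut-off.\<close>
lemma nn_integral_square_substitution:
  fixes f :: "real \<Rightarrow> ennreal"
  assumes [measurable]: "f \<in> borel_measurable borel"
  shows "(\<integral>\<^sup>+u. f u * indicator {0..} u \<partial>lborel)
    = (\<integral>\<^sup>+x. f (x\<^sup>2) * ennreal (2 * x) * indicator {0..} x \<partial>lborel)"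
proof -
  have step: "(\<integral>\<^sup>+u. f u * indicator {0..(real (Suc n))\<^sup>2} u \<partial>lborel)
      = (\<integral>\<^sup>+x. f (x\<^sup>2) * ennreal (2 * x) * indicator {0..real (Suc n)} x \<partial>lborel)" for n
  proof -
    have "((\<lambda>x. x\<^sup>2) has_real_derivative 2 * x) (at x)" for x :: real
      by (auto intro!: derivative_eq_intros)
    then show ?thesis
      using nn_integral_substitution_aux[of f 0 "real (Suc n)" "\<lambda>x. x\<^sup>2" "\<lambda>x. 2 * x"]
      by (simp add: continuous_intros del: of_nat_Suc)
  qed
  have union: "(\<Union>n. {0..(real (Suc n))\<^sup>2}) = {0..}" "(\<Union>n. {0..real (Suc n)}) = {0..}"
  proof -
    have "\<exists>n. x \<le> (real (Suc n))\<^sup>2" "\<exists>n. x \<le> real (Suc n)" for x :: real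
    proof -
      obtain n where n: "x \<le> real n" using real_arch_simple by blast
      then show "\<exists>n. x \<le> real (Suc n)" by (intro exI[of _ n]) simp
      have "real n + 1 \<le> (real (Suc n))\<^sup>2"
        by (simp add: power2_eq_square algebra_simps)
      then show "\<exists>n. x \<le> (real (Suc n))\<^sup>2" using n by (intro exI[of _ n]) linarith
    qed
    then show "(\<Union>n. {0..(real (Suc n))\<^sup>2}) = {0..}" "(\<Union>n. {0..real (Suc n)}) = {0..}"
      by auto
  qed
  have "(\<integral>\<^sup>+u. f u * indicator {0..} u \<partial>lborel)
      = (\<integral>\<^sup>+u. (SUP n. f u * indicator {0..(real (Suc n))\<^sup>2} u) \<partial>lborel)"
    by (intro nn_integral_cong) (simp only: SUP_mult_indicator union(1))
  also have "\<dots> = (SUP n. \<integral>\<^sup>+u. f u * indicator {0..(real (Suc n))\<^sup>2} u \<partial>lborel)"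
  proof (rule nn_integral_monotone_convergence_SUP)
    have "{0..(real (Suc m))\<^sup>2} \<subseteq> {0..(real (Suc n))\<^sup>2}" if "m \<le> n" for m n
      using that power_mono[of "real (Suc m)" "real (Suc n)" 2] by auto
    then show "incseq (\<lambda>n u. f u * indicator {0..(real (Suc n))\<^sup>2} u)"
      unfolding incseq_def le_fun_def by (auto intro!: mult_left_mono simp: indicator_def subset_iff del: atLeastAtMost_iff)
  qed simp
  also have "\<dots> = (SUP n. \<integral>\<^sup>+x. f (x\<^sup>2) * ennreal (2 * x) * indicator {0..real (Suc n)} x \<partial>lborel)"
    unfolding step ..
  also have "\<dots> = (\<integral>\<^sup>+x. (SUP n. f (x\<^sup>2) * ennreal (2 * x) * indicator {0..real (Suc n)} x) \<partial>lborel)"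
    by (intro nn_integral_monotone_convergence_SUP[symmetric])
       (auto simp: incseq_def le_fun_def intro!: mult_left_mono split: split_indicator)
  also have "\<dots> = (\<integral>\<^sup>+x. f (x\<^sup>2) * ennreal (2 * x) * indicator {0..} x \<partial>lborel)"
    by (intro nn_integral_cong) (simp only: SUP_mult_indicator union(2))
  finally show ?thesis .
qed


text \<open>Tonelli exchanges \<open>\<eta>\<close> and \<open>\<sigma>\<close>, so the inner integral is the density of \<open>\<sigma>\<close>; the Jacobian \<open>2 \<sigma>\<close> of squaring turns it into the density in \<open>u\<close>.\<close>
lemma distr_square_horseshoe_plus_scale:
  assumes \<tau>: "\<tau> > 0"
  shows "distr (horseshoe_plus_scale \<tau>) borel (\<lambda>\<sigma>. \<sigma>\<^sup>2) =
    density lborel (\<lambda>u. ennreal (horseshoe_plus_mixing_density \<tau> u))"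
proof (rule measure_eqI)
  fix A assume "A \<in> sets (distr (horseshoe_plus_scale \<tau>) borel (\<lambda>\<sigma>. \<sigma>\<^sup>2))"
  then have [measurable]: "A \<in> sets borel" by simp
  define g where "g u = ennreal (horseshoe_plus_mixing_density \<tau> u) * indicator A u" for u
  have [measurable]: "(\<lambda>u. horseshoe_plus_mixing_density \<tau> u) \<in> borel_measurable borel"
    unfolding horseshoe_plus_mixing_density_def by measurable
  have [measurable]: "g \<in> borel_measurable borel"
    unfolding g_def by measurable
  have "emeasure (distr (horseshoe_plus_scale \<tau>) borel (\<lambda>\<sigma>. \<sigma>\<^sup>2)) A
      = (\<integral>\<^sup>+\<sigma>. indicator A (\<sigma>\<^sup>2) \<partial>horseshoe_plus_scale \<tau>)"
    by (subst nn_integral_indicator[symmetric]) (simp_all add: nn_integral_distr del: nn_integral_indicator)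
  also have "\<dots> = (\<integral>\<^sup>+\<eta>. (\<integral>\<^sup>+\<sigma>. ennreal (half_cauchy_density 1 \<eta>) * (ennreal (half_cauchy_density (\<tau> * \<eta>) \<sigma>) * indicator A (\<sigma>\<^sup>2)) \<partial>lborel) \<partial>lborel)"
    by (subst nn_integral_horseshoe_plus_scale) (simp_all add: nn_integral_cmult)
  also have "\<dots> = (\<integral>\<^sup>+\<sigma>. (\<integral>\<^sup>+\<eta>. ennreal (half_cauchy_density 1 \<eta>) * (ennreal (half_cauchy_density (\<tau> * \<eta>) \<sigma>) * indicator A (\<sigma>\<^sup>2)) \<partial>lborel) \<partial>lborel)"
    by (rule lborel_pair.Fubini') simp
  also have "\<dots> = (\<integral>\<^sup>+\<sigma>. (\<integral>\<^sup>+\<eta>. ennreal (half_cauchy_density 1 \<eta>) * ennreal (half_cauchy_density (\<tau> * \<eta>) \<sigma>) \<partial>lborel) * indicator A (\<sigma>\<^sup>2) \<partial>lborel)"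
    by (simp add: nn_integral_multc mult.assoc[symmetric])
  also have "\<dots> = (\<integral>\<^sup>+\<sigma>. g (\<sigma>\<^sup>2) * ennreal (2 * \<sigma>) * indicator {0..} \<sigma> \<partial>lborel)"
  proof (rule nn_integral_cong_AE)
    show "AE \<sigma> in lborel. (\<integral>\<^sup>+\<eta>. ennreal (half_cauchy_density 1 \<eta>) * ennreal (half_cauchy_density (\<tau> * \<eta>) \<sigma>) \<partial>lborel) * indicator A (\<sigma>\<^sup>2)
        = g (\<sigma>\<^sup>2) * ennreal (2 * \<sigma>) * indicator {0..} \<sigma>"
      using AE_lborel_singleton[of \<tau>]
    proof eventually_elim
      case (elim \<sigma>)
      show ?case
      proof (cases "\<sigma> > 0")
        case True
        have "horseshoe_plus_mixing_density \<tau> (\<sigma>\<^sup>2) * (2 * \<sigma>) = 2 * \<tau> / pi\<^sup>2 * ln (\<sigma>\<^sup>2 / \<tau>\<^sup>2) / (\<sigma>\<^sup>2 - \<tau>\<^sup>2)"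
          using True by (simp add: horseshoe_plus_mixing_density_def powr_half_sqrt)
        moreover have "0 \<le> 2 * \<sigma>" using True by simp
        ultimately have "ennreal (2 * \<tau> / pi\<^sup>2 * ln (\<sigma>\<^sup>2 / \<tau>\<^sup>2) / (\<sigma>\<^sup>2 - \<tau>\<^sup>2))
            = ennreal (horseshoe_plus_mixing_density \<tau> (\<sigma>\<^sup>2)) * ennreal (2 * \<sigma>)"
          by (metis ennreal_mult'')
        then show ?thesis
          using True elim
          unfolding half_cauchy_mixture_density[OF \<tau> True elim] g_def
          by (simp add: ac_simps)
      next
        case False
        then have "half_cauchy_density q \<sigma> = 0" for q
          by (simp add: half_cauchy_density_def)
        then show ?thesis
          using False by (auto simp: ennreal_neg split: split_indicator)
      qed
    qed
  qed
  also have "\<dots> = (\<integral>\<^sup>+u. g u * indicator {0..} u \<partial>lborel)"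
    by (rule nn_integral_square_substitution[symmetric]) simp
  also have "\<dots> = (\<integral>\<^sup>+u. ennreal (horseshoe_plus_mixing_density \<tau> u) * indicator A u \<partial>lborel)"
    by (intro nn_integral_cong) (auto simp: g_def horseshoe_plus_mixing_density_def split: split_indicator)
  finally show "emeasure (distr (horseshoe_plus_scale \<tau>) borel (\<lambda>\<sigma>. \<sigma>\<^sup>2)) A
      = emeasure (density lborel (\<lambda>u. ennreal (horseshoe_plus_mixing_density \<tau> u))) A"
    by (simp add: emeasure_density)
qed simp

section \<open>Normal conjugacy given the scale\<close>

text \<open>The weight of the observation in the conditional posterior mean given \<open>\<sigma>\<close>, and also the conditional posterior variance.\<close>
definition shrinkage :: "real \<Rightarrow> real" where
  "shrinkage \<sigma> = \<sigma>\<^sup>2 / (1 + \<sigma>\<^sup>2)"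

lemma one_plus_square_pos: "1 + (\<sigma>::real)\<^sup>2 > 0"
  by (simp add: add_pos_nonneg)

lemma shrinkage_nonneg [simp]: "0 \<le> shrinkage \<sigma>"
  by (simp add: shrinkage_def add_nonneg_nonneg)

lemma shrinkage_le_1: "shrinkage \<sigma> \<le> 1"
  using one_plus_square_pos[of \<sigma>] by (simp add: shrinkage_def divide_simps)

lemma one_minus_shrinkage: "1 - shrinkage \<sigma> = 1 / (1 + \<sigma>\<^sup>2)"
  using one_plus_square_pos[of \<sigma>] by (simp add: shrinkage_def divide_simps)

lemma borel_measurable_shrinkage [measurable]: "shrinkage \<in> borel_measurable borel"
  unfolding shrinkage_def by measurable

lemma borel_measurable_normal_density_params [measurable (raw)]:
  assumes "m \<in> borel_measurable M" "s \<in> borel_measurable M" "f \<in> borel_measurable M"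
  shows "(\<lambda>x. normal_density (m x) (s x) (f x)) \<in> borel_measurable M"
  using assms unfolding normal_density_def by measurable

text \<open>Completing the square in \<open>\<theta>\<close>: the joint density of \<open>(\<theta>, x)\<close> is the marginal density of \<open>x\<close> times the posterior density of \<open>\<theta>\<close>.\<close>
lemma normal_conjugacy:
  assumes "\<sigma> \<noteq> 0"
  shows "normal_density 0 \<sigma> \<theta> * normal_density \<theta> 1 x
    = normal_density 0 (sqrt (1 + \<sigma>\<^sup>2)) x * normal_density (shrinkage \<sigma> * x) (sqrt (shrinkage \<sigma>)) \<theta>"
proof -
  have v: "1 + \<sigma>\<^sup>2 > 0" "\<sigma>\<^sup>2 > 0"
    using assms by (simp_all add: add_pos_nonneg)
  have factors: "sqrt (2 * pi * \<sigma>\<^sup>2) * sqrt (2 * pi) = sqrt (2 * pi * (1 + \<sigma>\<^sup>2)) * sqrt (2 * pi * shrinkage \<sigma>)"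
  proof -
    have "(2 * pi * \<sigma>\<^sup>2) * (2 * pi) = (2 * pi * (1 + \<sigma>\<^sup>2)) * (2 * pi * shrinkage \<sigma>)"
      using less_imp_neq[OF v(1)] by (simp add: shrinkage_def)
    then show ?thesis
      by (simp only: real_sqrt_mult[symmetric])
  qed
  have exponents: "\<theta>\<^sup>2 / (2 * \<sigma>\<^sup>2) + (x - \<theta>)\<^sup>2 / 2
      = x\<^sup>2 / (2 * (1 + \<sigma>\<^sup>2)) + (\<theta> - shrinkage \<sigma> * x)\<^sup>2 / (2 * shrinkage \<sigma>)"
  proof -
    have "(\<theta> - shrinkage \<sigma> * x)\<^sup>2 / (2 * shrinkage \<sigma>)
        = \<theta>\<^sup>2 * (1 + \<sigma>\<^sup>2) / (2 * \<sigma>\<^sup>2) - \<theta> * x + shrinkage \<sigma> * x\<^sup>2 / 2"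
      using v less_imp_neq[OF v(1)] by (simp add: shrinkage_def divide_simps) (simp add: algebra_simps power2_eq_square)
    moreover have "\<theta>\<^sup>2 * (1 + \<sigma>\<^sup>2) / (2 * \<sigma>\<^sup>2) = \<theta>\<^sup>2 / (2 * \<sigma>\<^sup>2) + \<theta>\<^sup>2 / 2"
      using v by (simp add: divide_simps) (simp add: algebra_simps)
    moreover have "x\<^sup>2 / (2 * (1 + \<sigma>\<^sup>2)) = (1 - shrinkage \<sigma>) * x\<^sup>2 / 2"
      unfolding one_minus_shrinkage by simp
    moreover have "(1 - shrinkage \<sigma>) * x\<^sup>2 / 2 = x\<^sup>2 / 2 - shrinkage \<sigma> * x\<^sup>2 / 2"
        "(x - \<theta>)\<^sup>2 / 2 = x\<^sup>2 / 2 - \<theta> * x + \<theta>\<^sup>2 / 2"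
      by (simp_all add: power2_eq_square field_simps)
    ultimately show ?thesis
      by linarith
  qed
  have "normal_density 0 \<sigma> \<theta> * normal_density \<theta> 1 x
      = 1 / (sqrt (2 * pi * \<sigma>\<^sup>2) * sqrt (2 * pi)) * exp (- (\<theta>\<^sup>2 / (2 * \<sigma>\<^sup>2) + (x - \<theta>)\<^sup>2 / 2))"
    by (simp add: normal_density_def mult_exp_exp)
  also have "\<dots> = normal_density 0 (sqrt (1 + \<sigma>\<^sup>2)) x * normal_density (shrinkage \<sigma> * x) (sqrt (shrinkage \<sigma>)) \<theta>"
    unfolding factors exponents using v by (simp add: normal_density_def mult_exp_exp)
  finally show ?thesis .
qed

lemma nn_integral_normal_density:
  assumes "s > 0"
  shows "(\<integral>\<^sup>+x. ennreal (normal_density m s x) \<partial>lborel) = 1"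
  using assms by (subst nn_integral_eq_integral) auto

lemma nn_integral_normal_second_moment:
  assumes s: "s > 0"
  shows "(\<integral>\<^sup>+x. ennreal (normal_density m s x) * ennreal ((x - a)\<^sup>2) \<partial>lborel) = ennreal (s\<^sup>2 + (m - a)\<^sup>2)"
proof -
  have expand: "normal_density m s x * (x - a)\<^sup>2
      = normal_density m s x * (x - m) ^ 2 + 2 * (m - a) * (normal_density m s x * (x - m) ^ 1)
        + (m - a)\<^sup>2 * normal_density m s x" for x
    by (simp add: power2_eq_square algebra_simps)
  have "integrable lborel (\<lambda>x. normal_density m s x * (x - a)\<^sup>2)"
    unfolding expand using s
    by (intro Bochner_Integration.integrable_add integrable_mult_right integrable_normal_moment integrable_normal_density)
  moreover have "(\<integral>x. normal_density m s x * (x - a)\<^sup>2 \<partial>lborel) = s\<^sup>2 + (m - a)\<^sup>2"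
  proof -
    have moments: "(\<integral>x. normal_density m s x * (x - m) ^ 2 \<partial>lborel) = s\<^sup>2"
        "(\<integral>x. normal_density m s x * (x - m) ^ 1 \<partial>lborel) = 0"
      using s integral_normal_moment_even[OF s, of m 1] integral_normal_moment_odd[OF s, of m 0]
      by simp_all
    show ?thesis
      unfolding expand using s
      by (subst Bochner_Integration.integral_add
            | intro Bochner_Integration.integrable_add integrable_mult_right integrable_normal_moment integrable_normal_density
            | simp only: integral_mult_right_zero moments integral_normal_density[OF s])+
  qed
  ultimately show ?thesis
    by (simp add: ennreal_mult[symmetric] nn_integral_eq_integral)
qed

lemma sets_normal_law [simp, measurable_cong]: "sets (normal_law m s) = sets borel"
  by (simp add: normal_law_def)

lemma space_normal_law [simp]: "space (normal_law m s) = UNIV"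
  by (simp add: normal_law_def)

lemma nn_integral_normal_law:
  fixes f :: "real \<Rightarrow> ennreal"
  assumes [measurable]: "f \<in> borel_measurable borel"
  shows "(\<integral>\<^sup>+x. f x \<partial>normal_law m s) = (\<integral>\<^sup>+x. ennreal (normal_density m s x) * f x \<partial>lborel)"
  unfolding normal_law_def by (subst nn_integral_density) auto

lemma emeasure_normal_law_UNIV: "emeasure (normal_law m s) UNIV = of_bool (s \<noteq> 0)"
proof -
  have "normal_density m s = normal_density m \<bar>s\<bar>"
    by (auto simp: normal_density_def)
  then show ?thesis
    unfolding normal_law_def
    by (subst emeasure_density) (cases "s = 0"; auto simp: nn_integral_normal_density normal_density_def[of m 0])+
qed

lemma prob_space_normal_law: "prob_space (normal_law m 1)"
  by (rule prob_spaceI) (simp add: emeasure_normal_law_UNIV)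

lemma measurable_normal_law [measurable]: "normal_law m \<in> borel \<rightarrow>\<^sub>M subprob_algebra borel"
proof (rule measurable_subprob_algebra)
  show "subprob_space (normal_law m s)" for s
    by (rule subprob_spaceI) (simp_all add: emeasure_normal_law_UNIV)
next
  fix A :: "real set" assume [measurable]: "A \<in> sets borel"
  have "emeasure (normal_law m s) A = (\<integral>\<^sup>+x. ennreal (normal_density m s x) * indicator A x \<partial>lborel)" for s
    unfolding normal_law_def by (subst emeasure_density) auto
  then show "(\<lambda>s. emeasure (normal_law m s) A) \<in> borel_measurable borel"
    by simp
qed simp

lemma sets_horseshoe_plus [simp, measurable_cong]: "sets (horseshoe_plus \<tau>) = sets borel"
  unfolding horseshoe_plus_def by (subst sets_bind) simp_all

lemma nn_integral_horseshoe_plus: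
  fixes f :: "real \<Rightarrow> ennreal"
  assumes [measurable]: "f \<in> borel_measurable borel"
  shows "(\<integral>\<^sup>+\<theta>. f \<theta> \<partial>horseshoe_plus \<tau>)
    = (\<integral>\<^sup>+\<sigma>. (\<integral>\<^sup>+\<theta>. ennreal (normal_density 0 \<sigma> \<theta>) * f \<theta> \<partial>lborel) \<partial>horseshoe_plus_scale \<tau>)"
  unfolding horseshoe_plus_def
  by (rule trans[OF nn_integral_bind[where B = borel]]) (simp_all add: nn_integral_normal_law)

lemma subprob_space_horseshoe_plus:
  assumes "\<tau> > 0"
  shows "subprob_space (horseshoe_plus \<tau>)"
  unfolding horseshoe_plus_def using prob_space_imp_subprob_space[OF prob_space_horseshoe_plus_scale[OF assms]]
  by (rule subprob_space_bind[where N = borel]) simp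

text \<open>Numerator and denominator of Bayes' formula in one coordinate: \<open>weighted_error \<nu> a x / evidence \<nu> x\<close>
  is the posterior expectation of \<open>(\<theta> - a)\<^sup>2\<close>.\<close>
definition evidence :: "real measure \<Rightarrow> real \<Rightarrow> ennreal" where
  "evidence \<nu> x = (\<integral>\<^sup>+\<theta>. ennreal (normal_density \<theta> 1 x) \<partial>\<nu>)"

definition weighted_error :: "real measure \<Rightarrow> real \<Rightarrow> real \<Rightarrow> ennreal" where
  "weighted_error \<nu> a x = (\<integral>\<^sup>+\<theta>. ennreal (normal_density \<theta> 1 x) * ennreal ((\<theta> - a)\<^sup>2) \<partial>\<nu>)"

lemma evidence_horseshoe_plus:
  "evidence (horseshoe_plus \<tau>) x
    = (\<integral>\<^sup>+\<sigma>. ennreal (normal_density 0 (sqrt (1 + \<sigma>\<^sup>2)) x) \<partial>horseshoe_plus_scale \<tau>)"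
  unfolding evidence_def
proof (subst nn_integral_horseshoe_plus, simp, rule nn_integral_cong_AE)
  show "AE \<sigma> in horseshoe_plus_scale \<tau>.
      (\<integral>\<^sup>+\<theta>. ennreal (normal_density 0 \<sigma> \<theta>) * ennreal (normal_density \<theta> 1 x) \<partial>lborel)
      = ennreal (normal_density 0 (sqrt (1 + \<sigma>\<^sup>2)) x)"
    using AE_horseshoe_plus_scale_pos
  proof eventually_elim
    case (elim \<sigma>)
    then have "sqrt (shrinkage \<sigma>) > 0" by (simp add: shrinkage_def one_plus_square_pos)
    then show ?case
      using elim
      by (simp add: ennreal_mult[symmetric] normal_conjugacy)
         (simp add: ennreal_mult nn_integral_cmult nn_integral_normal_density)
  qed
qed

lemma weighted_error_horseshoe_plus:
  "weighted_error (horseshoe_plus \<tau>) a x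
    = (\<integral>\<^sup>+\<sigma>. ennreal (normal_density 0 (sqrt (1 + \<sigma>\<^sup>2)) x)
          * ennreal ((shrinkage \<sigma> * x - a)\<^sup>2 + shrinkage \<sigma>) \<partial>horseshoe_plus_scale \<tau>)"
  unfolding weighted_error_def
proof (subst nn_integral_horseshoe_plus, simp, rule nn_integral_cong_AE)
  show "AE \<sigma> in horseshoe_plus_scale \<tau>.
      (\<integral>\<^sup>+\<theta>. ennreal (normal_density 0 \<sigma> \<theta>) * (ennreal (normal_density \<theta> 1 x) * ennreal ((\<theta> - a)\<^sup>2)) \<partial>lborel)
      = ennreal (normal_density 0 (sqrt (1 + \<sigma>\<^sup>2)) x) * ennreal ((shrinkage \<sigma> * x - a)\<^sup>2 + shrinkage \<sigma>)"
    using AE_horseshoe_plus_scale_pos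
  proof eventually_elim
    case (elim \<sigma>)
    then have pos: "sqrt (shrinkage \<sigma>) > 0" by (simp add: shrinkage_def one_plus_square_pos)
    have "(\<integral>\<^sup>+\<theta>. ennreal (normal_density 0 \<sigma> \<theta>) * (ennreal (normal_density \<theta> 1 x) * ennreal ((\<theta> - a)\<^sup>2)) \<partial>lborel)
        = (\<integral>\<^sup>+\<theta>. ennreal (normal_density 0 (sqrt (1 + \<sigma>\<^sup>2)) x)
            * (ennreal (normal_density (shrinkage \<sigma> * x) (sqrt (shrinkage \<sigma>)) \<theta>) * ennreal ((\<theta> - a)\<^sup>2)) \<partial>lborel)"
      using elim by (simp add: ennreal_mult[symmetric] normal_conjugacy mult.assoc[symmetric])
    also have "\<dots> = ennreal (normal_density 0 (sqrt (1 + \<sigma>\<^sup>2)) x) * ennreal ((shrinkage \<sigma> * x - a)\<^sup>2 + shrinkage \<sigma>)"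
      using pos by (subst nn_integral_cmult) (simp_all add: nn_integral_normal_second_moment add.commute)
    finally show ?case .
  qed
qed

section \<open>Product posteriors: reduction to one coordinate\<close>

text \<open>Jensen's inequality without an integrability hypothesis: if the right-hand side is finite, \<open>X\<close> is square integrable.\<close>
lemma (in prob_space) square_expectation_le:
  assumes X [measurable]: "X \<in> borel_measurable M"
  shows "ennreal ((expectation X - a)\<^sup>2) \<le> (\<integral>\<^sup>+\<omega>. ennreal ((X \<omega> - a)\<^sup>2) \<partial>M)"
proof (cases "(\<integral>\<^sup>+\<omega>. ennreal ((X \<omega> - a)\<^sup>2) \<partial>M) = \<infinity>")
  case False
  then have "(\<integral>\<^sup>+\<omega>. ennreal ((X \<omega> - a)\<^sup>2) \<partial>M) < \<infinity>"
    unfolding infinity_ennreal_def less_top .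
  then have sq: "integrable M (\<lambda>\<omega>. (X \<omega> - a)\<^sup>2)"
    by (intro integrableI_bounded) simp_all
  have int: "integrable M (\<lambda>\<omega>. X \<omega> - a)"
    by (rule square_integrable_imp_integrable[OF _ sq]) measurable
  have "integrable M (\<lambda>\<omega>. (X \<omega> - a) + a)"
    by (rule Bochner_Integration.integrable_add[OF int integrable_const])
  then have "integrable M X" by simp
  then have "expectation X - a = expectation (\<lambda>\<omega>. X \<omega> - a)"
    by (simp add: prob_space)
  also have "(\<dots>)\<^sup>2 \<le> expectation (\<lambda>\<omega>. (X \<omega> - a)\<^sup>2)"
    using variance_eq[OF int sq] variance_positive[of "\<lambda>\<omega>. X \<omega> - a"] by linarith
  finally show ?thesis
    by (subst nn_integral_eq_integral[OF sq]) (auto intro: ennreal_leI)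
qed simp

lemma sq_dist_eq_sum: "sq_dist n \<theta> \<theta>' = (\<Sum>i=1..n. (\<theta> i - \<theta>' i)\<^sup>2)"
  by (simp add: sq_dist_def L2_set_def sum_nonneg)

text \<open>A positive evidence is what keeps the normalisation in Bayes' formula away from \<open>0/0\<close>.\<close>
locale iid_normal_posterior =
  fixes \<nu> :: "real measure" and n :: nat
  assumes subprob: "subprob_space \<nu>"
    and sets_nu [simp, measurable_cong]: "sets \<nu> = sets borel"
    and evidence_pos: "\<And>x. evidence \<nu> x > 0"
begin

lemma evidence_finite: "evidence \<nu> x < \<infinity>"
proof -
  interpret subprob_space \<nu> by (rule subprob)
  have "normal_density \<theta> 1 x \<le> 1" for \<theta>
  proof -
    have "1 \<le> sqrt (2 * pi)" using pi_ge_two by (intro real_le_rsqrt) simp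
    moreover have "exp (- (x - \<theta>)\<^sup>2 / 2) \<le> 1" by simp
    ultimately have "exp (- (x - \<theta>)\<^sup>2 / 2) \<le> sqrt (2 * pi)" by linarith
    then show ?thesis
      by (simp add: normal_density_def divide_simps)
  qed
  then have "evidence \<nu> x \<le> (\<integral>\<^sup>+\<theta>. 1 \<partial>\<nu>)"
    unfolding evidence_def by (intro nn_integral_mono) (simp add: ennreal_le_1)
  also have "\<dots> < \<infinity>"
    using emeasure_finite[of "space \<nu>"] by (simp add: less_top[symmetric])
  finally show ?thesis .
qed

sublocale product_sigma_finite "\<lambda>_. \<nu>"
  by (rule product_sigma_finite.intro)
    (use subprob in \<open>simp add: subprob_space_def finite_measure_def\<close>)

lemma sets_iid_prior [simp, measurable_cong]: "sets (iid_prior n \<nu>) = sets (Pi\<^sub>M {1..n} (\<lambda>_. borel))"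
  unfolding iid_prior_def by (rule sets_PiM_cong) auto

lemma space_iid_prior: "space (iid_prior n \<nu>) = euclidean_points n"
  using sets_eq_imp_space_eq[OF sets_iid_prior] by (simp add: space_PiM euclidean_points_def)

lemma borel_measurable_likelihood [measurable]: "(\<lambda>\<theta>. likelihood n \<theta> x) \<in> borel_measurable (iid_prior n \<nu>)"
  unfolding likelihood_def by measurable

lemma nn_integral_likelihood:
  "(\<integral>\<^sup>+\<theta>. ennreal (likelihood n \<theta> x) \<partial>iid_prior n \<nu>) = (\<Prod>i=1..n. evidence \<nu> (x i))"
proof -
  have "(\<integral>\<^sup>+\<theta>. (\<Prod>i=1..n. ennreal (normal_density (\<theta> i) 1 (x i))) \<partial>Pi\<^sub>M {1..n} (\<lambda>_. \<nu>))
      = (\<Prod>i=1..n. \<integral>\<^sup>+\<theta>. ennreal (normal_density \<theta> 1 (x i)) \<partial>\<nu>)"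
    by (rule product_nn_integral_prod[where f = "\<lambda>i \<theta>. ennreal (normal_density \<theta> 1 (x i))"]) auto
  then show ?thesis
    by (simp add: likelihood_def iid_prior_def evidence_def prod_ennreal)
qed

lemma nn_integral_posterior:
  assumes [measurable]: "f \<in> borel_measurable (Pi\<^sub>M {1..n} (\<lambda>_. borel))"
  shows "(\<integral>\<^sup>+\<theta>. f \<theta> \<partial>posterior n (iid_prior n \<nu>) x)
    = (\<integral>\<^sup>+\<theta>. ennreal (likelihood n \<theta> x) * f \<theta> \<partial>iid_prior n \<nu>) / (\<Prod>i=1..n. evidence \<nu> (x i))"
proof -
  have "(\<integral>\<^sup>+\<theta>. f \<theta> \<partial>posterior n (iid_prior n \<nu>) x)
      = (\<integral>\<^sup>+\<theta>. ennreal (likelihood n \<theta> x) / (\<Prod>i=1..n. evidence \<nu> (x i)) * f \<theta> \<partial>iid_prior n \<nu>)"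
    unfolding posterior_def nn_integral_likelihood by (subst nn_integral_density) auto
  also have "\<dots> = (\<integral>\<^sup>+\<theta>. ennreal (likelihood n \<theta> x) * f \<theta> / (\<Prod>i=1..n. evidence \<nu> (x i)) \<partial>iid_prior n \<nu>)"
    by (simp only: ennreal_times_divide mult.commute[of _ "f _"])
  finally show ?thesis by (simp add: nn_integral_divide)
qed

lemma prod_evidence: "(\<Prod>i\<in>I. evidence \<nu> (x i)) \<noteq> 0" "(\<Prod>i\<in>I. evidence \<nu> (x i)) \<noteq> \<infinity>"
  using evidence_pos evidence_finite
  by (induction I rule: infinite_finite_induct)
     (auto simp: ennreal_mult_eq_top_iff less_top[symmetric] order_less_imp_not_eq2)

lemma prob_space_posterior: "prob_space (posterior n (iid_prior n \<nu>) x)"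
proof
  have "emeasure (posterior n (iid_prior n \<nu>) x) (space (posterior n (iid_prior n \<nu>) x))
      = (\<integral>\<^sup>+\<theta>. 1 \<partial>posterior n (iid_prior n \<nu>) x)"
    by simp
  also have "\<dots> = 1"
    using prod_evidence[of x "{1..n}"]
    by (subst nn_integral_posterior)
       (simp, simp only: mult_1_right nn_integral_likelihood ennreal_divide_self less_top[symmetric] infinity_ennreal_def simp_thms not_False_eq_True)
  finally show "emeasure (posterior n (iid_prior n \<nu>) x) (space (posterior n (iid_prior n \<nu>) x)) = 1" .
qed

text \<open>The likelihood is a product, so numerator and denominator are products of one-dimensional
  integrals, and all factors except the one of coordinate \<open>i\<close> cancel.\<close>
lemma posterior_coordinate_error:
  assumes i: "i \<in> {1..n}"
  shows "(\<integral>\<^sup>+\<theta>. ennreal ((\<theta> i - a)\<^sup>2) \<partial>posterior n (iid_prior n \<nu>) x)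
    = weighted_error \<nu> a (x i) / evidence \<nu> (x i)"
proof -
  define h where "h j \<theta> = ennreal (normal_density \<theta> 1 (x j)) * (if j = i then ennreal ((\<theta> - a)\<^sup>2) else 1)" for j \<theta>
  have h: "ennreal (likelihood n \<theta> x) * ennreal ((\<theta> i - a)\<^sup>2) = (\<Prod>j=1..n. h j (\<theta> j))" for \<theta>
    using i by (simp add: h_def prod.distrib likelihood_def prod_ennreal)
  have rest: "(\<Prod>j=1..n. g j) = g i * (\<Prod>j\<in>{1..n} - {i}. g j)" for g :: "nat \<Rightarrow> ennreal"
    using i by (intro prod.remove) auto
  let ?R = "\<Prod>j\<in>{1..n} - {i}. evidence \<nu> (x j)"
  have "(\<integral>\<^sup>+\<theta>. ennreal (likelihood n \<theta> x) * ennreal ((\<theta> i - a)\<^sup>2) \<partial>iid_prior n \<nu>)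
      = (\<Prod>j=1..n. \<integral>\<^sup>+\<theta>. h j \<theta> \<partial>\<nu>)"
    unfolding h iid_prior_def by (rule product_nn_integral_prod) (auto simp: h_def)
  also have "\<dots> = weighted_error \<nu> a (x i) * ?R"
    unfolding rest
    by (intro arg_cong2[where f = "(*)"] prod.cong) (auto simp: h_def[abs_def] weighted_error_def evidence_def)
  finally have "(\<integral>\<^sup>+\<theta>. ennreal ((\<theta> i - a)\<^sup>2) \<partial>posterior n (iid_prior n \<nu>) x)
      = (weighted_error \<nu> a (x i) * ?R) / (evidence \<nu> (x i) * ?R)"
    using i by (subst nn_integral_posterior) (simp_all add: rest[of "\<lambda>j. evidence \<nu> (x j)", simplified])
  also have "\<dots> = weighted_error \<nu> a (x i) / evidence \<nu> (x i)"
    using prod_evidence[of x "{1..n} - {i}"] by (simp add: divide_mult_eq)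
  finally show ?thesis .
qed

lemma sets_posterior [simp, measurable_cong]:
  "sets (posterior n (iid_prior n \<nu>) x) = sets (Pi\<^sub>M {1..n} (\<lambda>_. borel))"
  by (simp add: posterior_def)

lemma sets_sample_law [simp, measurable_cong]: "sets (sample_law n \<theta>) = sets (Pi\<^sub>M {1..n} (\<lambda>_. borel))"
  unfolding sample_law_def by (rule sets_PiM_cong) auto

text \<open>By \<open>posterior_error\<close> this is the posterior expectation of the squared distance to \<open>\<theta>\<^sub>0\<close>.\<close>
definition risk_sum :: "(nat \<Rightarrow> real) \<Rightarrow> (nat \<Rightarrow> real) \<Rightarrow> ennreal" where
  "risk_sum \<theta>\<^sub>0 x = (\<Sum>i=1..n. weighted_error \<nu> (\<theta>\<^sub>0 i) (x i) / evidence \<nu> (x i))"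

lemma posterior_error:
  "(\<integral>\<^sup>+\<theta>. ennreal (sq_dist n \<theta> \<theta>\<^sub>0) \<partial>posterior n (iid_prior n \<nu>) x) = risk_sum \<theta>\<^sub>0 x"
proof -
  have "(\<integral>\<^sup>+\<theta>. ennreal (sq_dist n \<theta> \<theta>\<^sub>0) \<partial>posterior n (iid_prior n \<nu>) x)
      = (\<integral>\<^sup>+\<theta>. (\<Sum>i=1..n. ennreal ((\<theta> i - \<theta>\<^sub>0 i)\<^sup>2)) \<partial>posterior n (iid_prior n \<nu>) x)"
    by (simp add: sq_dist_eq_sum sum_ennreal)
  also have "\<dots> = (\<Sum>i=1..n. \<integral>\<^sup>+\<theta>. ennreal ((\<theta> i - \<theta>\<^sub>0 i)\<^sup>2) \<partial>posterior n (iid_prior n \<nu>) x)"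
    by (rule nn_integral_sum) simp
  finally show ?thesis by (simp add: posterior_coordinate_error risk_sum_def)
qed

text \<open>Jensen's inequality in each coordinate.\<close>
lemma posterior_mean_error:
  "ennreal (sq_dist n (posterior_mean n (iid_prior n \<nu>) x) \<theta>\<^sub>0) \<le> risk_sum \<theta>\<^sub>0 x"
proof -
  interpret post: prob_space "posterior n (iid_prior n \<nu>) x" by (rule prob_space_posterior)
  have "ennreal (sq_dist n (posterior_mean n (iid_prior n \<nu>) x) \<theta>\<^sub>0)
      = (\<Sum>i=1..n. ennreal ((post.expectation (\<lambda>\<theta>. \<theta> i) - \<theta>\<^sub>0 i)\<^sup>2))"
    by (simp add: sq_dist_eq_sum sum_ennreal posterior_mean_def)
  also have "\<dots> \<le> risk_sum \<theta>\<^sub>0 x"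
    unfolding risk_sum_def
  proof (rule sum_mono)
    fix i assume i: "i \<in> {1..n}"
    show "ennreal ((post.expectation (\<lambda>\<theta>. \<theta> i) - \<theta>\<^sub>0 i)\<^sup>2)
        \<le> weighted_error \<nu> (\<theta>\<^sub>0 i) (x i) / evidence \<nu> (x i)"
      unfolding posterior_coordinate_error[OF i, where a = "\<theta>\<^sub>0 i" and x = x, symmetric]
    proof (rule post.square_expectation_le)
      show "(\<lambda>\<theta>. \<theta> i) \<in> borel_measurable (posterior n (iid_prior n \<nu>) x)"
        using measurable_component_singleton[OF i, of "\<lambda>_. borel"]
        by (simp add: measurable_cong_sets[OF sets_posterior refl])
    qed
  qed
  finally show ?thesis .
qed

lemma posterior_tail:
  assumes "c > 0"
  shows "emeasure (posterior n (iid_prior n \<nu>) x) {\<theta> \<in> euclidean_points n. sq_dist n \<theta> \<theta>\<^sub>0 > c}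
    \<le> risk_sum \<theta>\<^sub>0 x / ennreal c"
proof -
  let ?P = "posterior n (iid_prior n \<nu>) x"
  have [simp]: "space ?P = euclidean_points n"
    by (simp add: posterior_def space_iid_prior)
  have error_measurable: "(\<lambda>\<theta>. ennreal (sq_dist n \<theta> \<theta>\<^sub>0)) \<in> borel_measurable ?P"
    unfolding sq_dist_eq_sum by measurable
  have "emeasure ?P {\<theta> \<in> euclidean_points n. sq_dist n \<theta> \<theta>\<^sub>0 > c}
      \<le> emeasure ?P {\<theta> \<in> space ?P. 1 \<le> ennreal (1 / c) * ennreal (sq_dist n \<theta> \<theta>\<^sub>0)}"
  proof (rule emeasure_mono)
    have "1 \<le> ennreal (1 / c) * ennreal (sq_dist n \<theta> \<theta>\<^sub>0)" if "sq_dist n \<theta> \<theta>\<^sub>0 > c" for \<theta>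
    proof -
      have "1 \<le> 1 / c * sq_dist n \<theta> \<theta>\<^sub>0"
        using that assms by (simp add: field_simps)
      then have "ennreal 1 \<le> ennreal (1 / c * sq_dist n \<theta> \<theta>\<^sub>0)"
        by (rule ennreal_leI)
      then show ?thesis
        using that assms by (subst ennreal_mult[symmetric]) auto
    qed
    then show "{\<theta> \<in> euclidean_points n. sq_dist n \<theta> \<theta>\<^sub>0 > c}
        \<subseteq> {\<theta> \<in> space ?P. 1 \<le> ennreal (1 / c) * ennreal (sq_dist n \<theta> \<theta>\<^sub>0)}"
      by auto
    show "{\<theta> \<in> space ?P. 1 \<le> ennreal (1 / c) * ennreal (sq_dist n \<theta> \<theta>\<^sub>0)} \<in> sets ?P"
      using error_measurable by (intro borel_measurable_le borel_measurable_const borel_measurable_times_ennreal)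
  qed
  also have "\<dots> \<le> ennreal (1 / c) * (\<integral>\<^sup>+\<theta>. ennreal (sq_dist n \<theta> \<theta>\<^sub>0) * indicator (space ?P) \<theta> \<partial>?P)"
  proof (rule nn_integral_Markov_inequality)
    show "space ?P \<in> sets ?P" by (rule sets.top)
    show "(\<lambda>\<theta>. ennreal (sq_dist n \<theta> \<theta>\<^sub>0) * indicator (space ?P) \<theta>) \<in> borel_measurable ?P"
      by (rule borel_measurable_times_ennreal[OF error_measurable borel_measurable_indicator[OF sets.top]])
  qed
  also have "(\<integral>\<^sup>+\<theta>. ennreal (sq_dist n \<theta> \<theta>\<^sub>0) * indicator (space ?P) \<theta> \<partial>?P)
      = (\<integral>\<^sup>+\<theta>. ennreal (sq_dist n \<theta> \<theta>\<^sub>0) \<partial>?P)"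
    by (intro nn_integral_cong) simp
  finally show ?thesis
    using assms by (simp add: posterior_error divide_ennreal_def inverse_ennreal inverse_eq_divide mult.commute)
qed

lemma borel_measurable_evidence [measurable]: "evidence \<nu> \<in> borel_measurable borel"
proof -
  interpret subprob_space \<nu> by (rule subprob)
  show ?thesis
    unfolding evidence_def[abs_def] by (rule borel_measurable_nn_integral) simp
qed

lemma borel_measurable_weighted_error [measurable]: "weighted_error \<nu> a \<in> borel_measurable borel"
proof -
  interpret subprob_space \<nu> by (rule subprob)
  show ?thesis
    unfolding weighted_error_def[abs_def] by (rule borel_measurable_nn_integral) simp
qed

lemma borel_measurable_coordinate_risk:
  "(\<lambda>y. weighted_error \<nu> a y / evidence \<nu> y) \<in> borel_measurable borel"
  by measurable

lemma borel_measurable_coordinate_risk_sample: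
  assumes "i \<in> {1..n}"
  shows "(\<lambda>x. weighted_error \<nu> a (x i) / evidence \<nu> (x i)) \<in> borel_measurable (sample_law n \<theta>)"
  using measurable_compose[OF measurable_component_singleton[OF assms] borel_measurable_coordinate_risk]
  by (simp add: measurable_cong_sets[OF sets_sample_law refl])

lemma borel_measurable_risk_sum: "risk_sum \<theta>\<^sub>0 \<in> borel_measurable (sample_law n \<theta>)"
  unfolding risk_sum_def[abs_def]
  by (intro borel_measurable_sum borel_measurable_coordinate_risk_sample)

text \<open>Each summand depends on one coordinate of the sample only, so its expectation is an integral over the real line.\<close>
lemma nn_integral_risk_sum:
  "(\<integral>\<^sup>+x. risk_sum \<theta>\<^sub>0 x \<partial>sample_law n \<theta>\<^sub>0)
    = (\<Sum>i=1..n. \<integral>\<^sup>+x. ennreal (normal_density (\<theta>\<^sub>0 i) 1 x) * (weighted_error \<nu> (\<theta>\<^sub>0 i) x / evidence \<nu> x) \<partial>lborel)"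
proof -
  have coordinate: "(\<integral>\<^sup>+x. g (x i) \<partial>sample_law n \<theta>\<^sub>0) = (\<integral>\<^sup>+x. ennreal (normal_density (\<theta>\<^sub>0 i) 1 x) * g x \<partial>lborel)"
    if i: "i \<in> {1..n}" and [measurable]: "g \<in> borel_measurable borel" for i g
  proof -
    have "(\<integral>\<^sup>+x. g (x i) \<partial>sample_law n \<theta>\<^sub>0)
        = (\<integral>\<^sup>+y. g y \<partial>distr (sample_law n \<theta>\<^sub>0) (normal_law (\<theta>\<^sub>0 i) 1) (\<lambda>x. x i))"
    proof (rule nn_integral_distr[symmetric])
      show "(\<lambda>x. x i) \<in> sample_law n \<theta>\<^sub>0 \<rightarrow>\<^sub>M normal_law (\<theta>\<^sub>0 i) 1"
        unfolding sample_law_def by (rule measurable_component_singleton[OF i])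
    qed simp
    also have "distr (sample_law n \<theta>\<^sub>0) (normal_law (\<theta>\<^sub>0 i) 1) (\<lambda>x. x i) = normal_law (\<theta>\<^sub>0 i) 1"
      unfolding sample_law_def using i by (intro distr_PiM_component prob_space_normal_law)
    finally show ?thesis by (simp add: nn_integral_normal_law)
  qed
  have "(\<integral>\<^sup>+x. risk_sum \<theta>\<^sub>0 x \<partial>sample_law n \<theta>\<^sub>0)
      = (\<Sum>i=1..n. \<integral>\<^sup>+x. weighted_error \<nu> (\<theta>\<^sub>0 i) (x i) / evidence \<nu> (x i) \<partial>sample_law n \<theta>\<^sub>0)"
    unfolding risk_sum_def
    by (intro nn_integral_sum borel_measurable_coordinate_risk_sample)
  also have "\<dots> = (\<Sum>i=1..n. \<integral>\<^sup>+x. ennreal (normal_density (\<theta>\<^sub>0 i) 1 x) * (weighted_error \<nu> (\<theta>\<^sub>0 i) x / evidence \<nu> x) \<partial>lborel)"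
  proof (rule sum.cong[OF refl])
    fix i assume i: "i \<in> {1..n}"
    show "(\<integral>\<^sup>+x. weighted_error \<nu> (\<theta>\<^sub>0 i) (x i) / evidence \<nu> (x i) \<partial>sample_law n \<theta>\<^sub>0)
        = (\<integral>\<^sup>+x. ennreal (normal_density (\<theta>\<^sub>0 i) 1 x) * (weighted_error \<nu> (\<theta>\<^sub>0 i) x / evidence \<nu> x) \<partial>lborel)"
      using coordinate[OF i borel_measurable_coordinate_risk] .
  qed
  finally show ?thesis .
qed

end

section \<open>Lower bounds on the evidence\<close>

lemma nn_integral_half_cauchy_density_Icc:
  assumes "q > 0" "0 \<le> a" "a \<le> b"
  shows "(\<integral>\<^sup>+x. ennreal (half_cauchy_density q x) * indicator {a..b} x \<partial>lborel)
    = ennreal (2 * arctan (b / q) / pi - 2 * arctan (a / q) / pi)"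
proof -
  have "(\<integral>\<^sup>+x. ennreal (half_cauchy_density q x) * indicator {a..b} x \<partial>lborel)
      = (\<integral>\<^sup>+x. ennreal (2 * q / (pi * (q\<^sup>2 + x\<^sup>2))) * indicator {a..b} x \<partial>lborel)"
    using assms AE_lborel_singleton[of "0::real"]
    by (intro nn_integral_cong_AE)
       (auto elim!: eventually_mono simp: half_cauchy_density_def split: split_indicator)
  also have "\<dots> = ennreal (2 * arctan (b / q) / pi - 2 * arctan (a / q) / pi)"
    using assms by (intro nn_integral_FTC_Icc) (auto intro!: arctan_scaled_derivative)
  finally show ?thesis .
qed

text \<open>The median of a half-Cauchy law is its scale.\<close>
lemma half_cauchy_le_scale:
  assumes "0 < q" "q \<le> 1"
  shows "ennreal (1 / 2) \<le> (\<integral>\<^sup>+x. ennreal (half_cauchy_density q x) * indicator {0..1} x \<partial>lborel)"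
proof -
  have "arctan 1 \<le> arctan (1 / q)"
    using assms by (intro arctan_monotone') simp
  then have "1 / 2 \<le> 2 * arctan (1 / q) / pi"
    unfolding arctan_one by (simp add: field_simps)
  then have "ennreal (1 / 2) \<le> ennreal (2 * arctan (1 / q) / pi - 2 * arctan (0 / q) / pi)"
    by (intro ennreal_leI) simp
  then show ?thesis
    using assms by (subst nn_integral_half_cauchy_density_Icc) simp_all
qed

text \<open>Both \<open>\<eta> \<le> 1\<close> and, given that, \<open>\<sigma> \<le> 1\<close> have probability at least \<open>1/2\<close>.\<close>
lemma horseshoe_plus_scale_small:
  assumes \<tau>: "0 < \<tau>" "\<tau> \<le> 1"
  shows "ennreal (1 / 4) \<le> (\<integral>\<^sup>+\<sigma>. indicator {0..1} \<sigma> \<partial>horseshoe_plus_scale \<tau>)"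
proof -
  have "ennreal (1 / 4) = ennreal (1 / 2) * ennreal (1 / 2)"
    by (subst ennreal_mult[symmetric]) auto
  also have "\<dots> \<le> (\<integral>\<^sup>+\<eta>. ennreal (half_cauchy_density 1 \<eta>) * indicator {0..1} \<eta> \<partial>lborel) * ennreal (1 / 2)"
    by (intro mult_right_mono half_cauchy_le_scale) auto
  also have "\<dots> = (\<integral>\<^sup>+\<eta>. ennreal (half_cauchy_density 1 \<eta>) * indicator {0..1} \<eta> * ennreal (1 / 2) \<partial>lborel)"
    by (rule nn_integral_multc[symmetric]) measurable
  also have "\<dots> \<le> (\<integral>\<^sup>+\<eta>. ennreal (half_cauchy_density 1 \<eta>)
      * (\<integral>\<^sup>+\<sigma>. ennreal (half_cauchy_density (\<tau> * \<eta>) \<sigma>) * indicator {0..1} \<sigma> \<partial>lborel) \<partial>lborel)"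
  proof (rule nn_integral_mono)
    fix \<eta> :: real
    show "ennreal (half_cauchy_density 1 \<eta>) * indicator {0..1} \<eta> * ennreal (1 / 2)
        \<le> ennreal (half_cauchy_density 1 \<eta>)
          * (\<integral>\<^sup>+\<sigma>. ennreal (half_cauchy_density (\<tau> * \<eta>) \<sigma>) * indicator {0..1} \<sigma> \<partial>lborel)"
    proof (cases "0 < \<eta> \<and> \<eta> \<le> 1")
      case True
      then have "0 < \<tau> * \<eta>" "\<tau> * \<eta> \<le> 1"
        using \<tau> mult_mono[of \<tau> 1 \<eta> 1] by auto
      then have "ennreal (half_cauchy_density 1 \<eta>) * ennreal (1 / 2) \<le> ennreal (half_cauchy_density 1 \<eta>)
          * (\<integral>\<^sup>+\<sigma>. ennreal (half_cauchy_density (\<tau> * \<eta>) \<sigma>) * indicator {0..1} \<sigma> \<partial>lborel)"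
        by (intro mult_left_mono half_cauchy_le_scale) auto
      then show ?thesis
        using True by simp
    next
      case False
      then show ?thesis
        by (auto simp: half_cauchy_density_def[of 1] split: split_indicator)
    qed
  qed
  also have "\<dots> = (\<integral>\<^sup>+\<sigma>. indicator {0..1} \<sigma> \<partial>horseshoe_plus_scale \<tau>)"
    by (subst nn_integral_horseshoe_plus_scale) auto
  finally show ?thesis .
qed

text \<open>For \<open>\<sigma> \<le> 1\<close> the marginal law \<open>N(0, 1+\<sigma>\<^sup>2)\<close> has a density at least half the standard normal one,
  and such scales have prior mass at least \<open>1/4\<close>.\<close>
lemma evidence_ge_null_density:
  assumes \<tau>: "0 < \<tau>" "\<tau> \<le> 1"
  shows "ennreal (normal_density 0 1 x) \<le> 8 * evidence (horseshoe_plus \<tau>) x"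
proof -
  have pointwise: "normal_density 0 1 x / 2 \<le> normal_density 0 (sqrt (1 + \<sigma>\<^sup>2)) x" if "\<sigma> \<in> {0..1}" for \<sigma>
  proof -
    have s: "1 \<le> 1 + \<sigma>\<^sup>2" "1 + \<sigma>\<^sup>2 \<le> 4"
      using that power_le_one[of \<sigma> 2] by auto
    have "x\<^sup>2 / (2 * (1 + \<sigma>\<^sup>2)) \<le> x\<^sup>2 / 2"
      using s by (intro divide_left_mono mult_pos_pos one_plus_square_pos) auto
    moreover have "1 / sqrt (2 * pi) / 2 \<le> 1 / sqrt (2 * pi * (1 + \<sigma>\<^sup>2))"
    proof -
      have "sqrt (2 * pi * (1 + \<sigma>\<^sup>2)) \<le> sqrt (2 * pi * 4)"
        using s by simp
      also have "\<dots> = sqrt (2 * pi) * 2"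
        by (simp only: real_sqrt_mult real_sqrt_four)
      finally have "1 / (sqrt (2 * pi) * 2) \<le> 1 / sqrt (2 * pi * (1 + \<sigma>\<^sup>2))"
        by (intro divide_left_mono mult_pos_pos real_sqrt_gt_zero one_plus_square_pos) simp_all
      then show ?thesis by simp
    qed
    ultimately have "1 / sqrt (2 * pi) / 2 * exp (- (x\<^sup>2 / 2)) \<le> 1 / sqrt (2 * pi * (1 + \<sigma>\<^sup>2)) * exp (- (x\<^sup>2 / (2 * (1 + \<sigma>\<^sup>2))))"
      by (intro mult_mono) auto
    then show ?thesis
      using s by (simp add: normal_density_def)
  qed
  have "ennreal (normal_density 0 1 x) = ennreal (8 * (normal_density 0 1 x / 2 * (1 / 4)))"
    by simp
  also have "\<dots> = 8 * (ennreal (normal_density 0 1 x / 2) * ennreal (1 / 4))"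
    by (subst ennreal_mult', simp, subst ennreal_mult'', simp, simp only: ennreal_numeral)
  also have "\<dots> \<le> 8 * (ennreal (normal_density 0 1 x / 2) * (\<integral>\<^sup>+\<sigma>. indicator {0..1} \<sigma> \<partial>horseshoe_plus_scale \<tau>))"
    by (intro mult_left_mono horseshoe_plus_scale_small \<tau>) auto
  also have "\<dots> = 8 * (\<integral>\<^sup>+\<sigma>. ennreal (normal_density 0 1 x / 2) * indicator {0..1} \<sigma> \<partial>horseshoe_plus_scale \<tau>)"
    by (subst nn_integral_cmult) auto
  also have "\<dots> \<le> 8 * evidence (horseshoe_plus \<tau>) x"
    unfolding evidence_horseshoe_plus
  proof (intro mult_left_mono nn_integral_mono)
    show "ennreal (normal_density 0 1 x / 2) * indicator {0..1} \<sigma> \<le> ennreal (normal_density 0 (sqrt (1 + \<sigma>\<^sup>2)) x)" for \<sigma>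
      using ennreal_leI[OF pointwise, of \<sigma>] by (cases "\<sigma> \<in> {0..1}") simp_all
  qed simp
  finally show ?thesis .
qed

text \<open>For \<open>\<eta>\<close> between \<open>1\<close> and \<open>2\<close> and \<open>\<sigma>\<close> of order \<open>y\<close>, the half-Cauchy density of \<open>\<sigma>\<close> is of order \<open>\<tau>/y\<^sup>2\<close>.\<close>
lemma horseshoe_plus_scale_interval:
  assumes \<tau>: "0 < \<tau>" "\<tau> \<le> 1" and y: "y \<ge> 1"
  shows "ennreal (\<tau> / (10 * pi\<^sup>2 * y)) \<le> (\<integral>\<^sup>+\<sigma>. indicator {y..2 * y} \<sigma> \<partial>horseshoe_plus_scale \<tau>)"
proof -
  have inner: "ennreal (\<tau> / (4 * pi * y))
      \<le> (\<integral>\<^sup>+\<sigma>. ennreal (half_cauchy_density (\<tau> * \<eta>) \<sigma>) * indicator {y..2 * y} \<sigma> \<partial>lborel)"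
    if \<eta>: "\<eta> \<in> {1..2}" for \<eta>
  proof -
    have "ennreal (\<tau> / (4 * pi * y)) = ennreal (\<tau> / (4 * pi * y\<^sup>2)) * ennreal y"
      using \<tau> y by (subst ennreal_mult[symmetric]) (auto simp: power2_eq_square)
    also have "\<dots> = (\<integral>\<^sup>+\<sigma>. ennreal (\<tau> / (4 * pi * y\<^sup>2)) * indicator {y..2 * y} \<sigma> \<partial>lborel)"
      using y by (subst nn_integral_cmult_indicator) auto
    also have "\<dots> \<le> (\<integral>\<^sup>+\<sigma>. ennreal (half_cauchy_density (\<tau> * \<eta>) \<sigma>) * indicator {y..2 * y} \<sigma> \<partial>lborel)"
    proof (intro nn_integral_mono)
      fix \<sigma> :: real
      have "\<tau> / (4 * pi * y\<^sup>2) \<le> half_cauchy_density (\<tau> * \<eta>) \<sigma>" if \<sigma>: "\<sigma> \<in> {y..2 * y}"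
      proof -
        have "(\<tau> * \<eta>)\<^sup>2 \<le> 2\<^sup>2"
          using \<tau> \<eta> mult_mono[of \<tau> 1 \<eta> 2] by (intro power_mono) auto
        moreover have "\<sigma>\<^sup>2 \<le> (2 * y)\<^sup>2"
          using \<sigma> y by (intro power_mono) auto
        moreover have "1 \<le> y\<^sup>2"
          using y by simp
        ultimately have "(\<tau> * \<eta>)\<^sup>2 + \<sigma>\<^sup>2 \<le> 8 * y\<^sup>2"
          by (simp add: power_mult_distrib)
        moreover have "0 < (\<tau> * \<eta>)\<^sup>2 + \<sigma>\<^sup>2"
          using \<sigma> y by (intro add_nonneg_pos) auto
        moreover have "2 * \<tau> \<le> 2 * (\<tau> * \<eta>)"
          using \<tau> \<eta> by simp
        ultimately have "2 * \<tau> / (pi * (8 * y\<^sup>2)) \<le> 2 * (\<tau> * \<eta>) / (pi * ((\<tau> * \<eta>)\<^sup>2 + \<sigma>\<^sup>2))"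
          using \<tau> by (intro frac_le mult_left_mono) auto
        then show ?thesis
          using \<tau> \<eta> \<sigma> y by (simp add: half_cauchy_density_def)
      qed
      then show "ennreal (\<tau> / (4 * pi * y\<^sup>2)) * indicator {y..2 * y} \<sigma>
          \<le> ennreal (half_cauchy_density (\<tau> * \<eta>) \<sigma>) * indicator {y..2 * y} \<sigma>"
        by (auto intro!: ennreal_leI split: split_indicator)
    qed
    finally show ?thesis .
  qed
  have "ennreal (\<tau> / (10 * pi\<^sup>2 * y)) = (\<integral>\<^sup>+(\<eta>::real). ennreal (2 / (5 * pi) * (\<tau> / (4 * pi * y))) * indicator {1..2} \<eta> \<partial>lborel)"
    by (subst nn_integral_cmult_indicator) (auto simp: power2_eq_square mult.assoc)
  also have "\<dots> \<le> (\<integral>\<^sup>+\<eta>. ennreal (half_cauchy_density 1 \<eta>)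
      * (\<integral>\<^sup>+\<sigma>. ennreal (half_cauchy_density (\<tau> * \<eta>) \<sigma>) * indicator {y..2 * y} \<sigma> \<partial>lborel) \<partial>lborel)"
  proof (intro nn_integral_mono)
    fix \<eta> :: real
    show "ennreal (2 / (5 * pi) * (\<tau> / (4 * pi * y))) * indicator {1..2} \<eta>
      \<le> ennreal (half_cauchy_density 1 \<eta>)
        * (\<integral>\<^sup>+\<sigma>. ennreal (half_cauchy_density (\<tau> * \<eta>) \<sigma>) * indicator {y..2 * y} \<sigma> \<partial>lborel)"
    proof (cases "\<eta> \<in> {1..2}")
      case True
      then have "\<eta>\<^sup>2 \<le> 2\<^sup>2"
        by (intro power_mono) auto
      then have "2 / (pi * 5) \<le> 2 / (pi * (1\<^sup>2 + \<eta>\<^sup>2))"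
        by (intro divide_left_mono mult_left_mono) (auto intro!: mult_pos_pos add_pos_nonneg)
      then have "2 / (5 * pi) \<le> half_cauchy_density 1 \<eta>"
        using True by (simp add: half_cauchy_density_def mult.commute)
      then have "ennreal (2 / (5 * pi)) * ennreal (\<tau> / (4 * pi * y)) \<le> ennreal (half_cauchy_density 1 \<eta>)
        * (\<integral>\<^sup>+\<sigma>. ennreal (half_cauchy_density (\<tau> * \<eta>) \<sigma>) * indicator {y..2 * y} \<sigma> \<partial>lborel)"
        using inner[OF True] by (intro mult_mono ennreal_leI) auto
      then show ?thesis
        using True \<tau> y by (subst ennreal_mult) auto
    qed auto
  qed
  also have "\<dots> = (\<integral>\<^sup>+\<sigma>. indicator {y..2 * y} \<sigma> \<partial>horseshoe_plus_scale \<tau>)"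
    by (subst nn_integral_horseshoe_plus_scale) auto
  finally show ?thesis .
qed

text \<open>Scales \<open>\<sigma>\<close> of order \<open>|x|\<close> explain the observation: their marginal density at \<open>x\<close> is of order \<open>1/|x|\<close>,
  and their prior mass is of order \<open>\<tau>/|x|\<close>.\<close>
lemma evidence_polynomial_lower_bound:
  assumes \<tau>: "0 < \<tau>" "\<tau> \<le> 1" and x: "\<bar>x\<bar> \<ge> 1"
  shows "ennreal (\<tau> / (120 * pi\<^sup>2 * x\<^sup>2)) \<le> evidence (horseshoe_plus \<tau>) x"
proof -
  define y where "y = \<bar>x\<bar>"
  have y: "y \<ge> 1" "x\<^sup>2 = y\<^sup>2" using x by (auto simp: y_def)
  have pointwise: "1 / (12 * y) \<le> normal_density 0 (sqrt (1 + \<sigma>\<^sup>2)) x" if \<sigma>: "\<sigma> \<in> {y..2 * y}" for \<sigma>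
  proof -
    have sq: "y\<^sup>2 \<le> \<sigma>\<^sup>2" "\<sigma>\<^sup>2 \<le> (2 * y)\<^sup>2" "1 \<le> y\<^sup>2"
      using \<sigma> y power_mono[of \<sigma> "2 * y" 2] by (auto intro!: power_mono)
    have "sqrt (2 * pi * (1 + \<sigma>\<^sup>2)) \<le> sqrt (36 * y\<^sup>2)"
    proof (rule real_sqrt_le_mono)
      \<comment> \<open>\<open>18/5\<close> is a convenient bound for \<open>\<pi>\<close>, since then \<open>36 y\<^sup>2\<close> is a square\<close>
      have "2 * pi * (1 + \<sigma>\<^sup>2) \<le> 2 * (18 / 5) * (5 * y\<^sup>2)"
        using sq pi_approx by (intro mult_mono) auto
      then show "2 * pi * (1 + \<sigma>\<^sup>2) \<le> 36 * y\<^sup>2" by simp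
    qed
    also have "\<dots> = 6 * y"
      using y by (simp add: real_sqrt_mult)
    finally have "1 / (6 * y) \<le> 1 / sqrt (2 * pi * (1 + \<sigma>\<^sup>2))"
      using y by (intro divide_left_mono) (auto intro!: mult_pos_pos add_pos_nonneg)
    moreover have "1 / 2 \<le> exp (- (x\<^sup>2 / (2 * (1 + \<sigma>\<^sup>2))))"
    proof -
      have "x\<^sup>2 / (2 * (1 + \<sigma>\<^sup>2)) \<le> 1 / 2"
        using sq y by (simp add: divide_simps)
      then have "1 / 2 \<le> 1 + - (x\<^sup>2 / (2 * (1 + \<sigma>\<^sup>2)))" by simp
      also have "\<dots> \<le> exp (- (x\<^sup>2 / (2 * (1 + \<sigma>\<^sup>2))))" by (rule exp_ge_add_one_self)
      finally show ?thesis .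
    qed
    ultimately have "1 / (6 * y) * (1 / 2) \<le> 1 / sqrt (2 * pi * (1 + \<sigma>\<^sup>2)) * exp (- (x\<^sup>2 / (2 * (1 + \<sigma>\<^sup>2))))"
      by (intro mult_mono) auto
    then show ?thesis
      by (simp add: normal_density_def)
  qed
  have "ennreal (\<tau> / (120 * pi\<^sup>2 * x\<^sup>2)) = ennreal (1 / (12 * y)) * ennreal (\<tau> / (10 * pi\<^sup>2 * y))"
    using \<tau> y by (subst ennreal_mult[symmetric]) (auto simp: power2_eq_square)
  also have "\<dots> \<le> ennreal (1 / (12 * y)) * (\<integral>\<^sup>+\<sigma>. indicator {y..2 * y} \<sigma> \<partial>horseshoe_plus_scale \<tau>)"
    by (intro mult_left_mono horseshoe_plus_scale_interval \<tau> y) auto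
  also have "\<dots> = (\<integral>\<^sup>+\<sigma>. ennreal (1 / (12 * y)) * indicator {y..2 * y} \<sigma> \<partial>horseshoe_plus_scale \<tau>)"
    by (subst nn_integral_cmult) auto
  also have "\<dots> \<le> evidence (horseshoe_plus \<tau>) x"
    unfolding evidence_horseshoe_plus
    by (intro nn_integral_mono) (auto intro!: ennreal_leI pointwise split: split_indicator)
  finally show ?thesis .
qed

section \<open>Bias of large observations\<close>

lemma ennreal_ratio_le:
  fixes a b c :: ennreal
  assumes "a \<le> c * b" "b \<noteq> 0" "b \<noteq> \<infinity>"
  shows "a / b \<le> c"
proof -
  have "a / b \<le> c * b / b"
    by (rule divide_right_mono_ennreal) fact
  also have "\<dots> = c"
    using assms by (simp add: ennreal_mult_divide_eq)
  finally show ?thesis .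
qed

lemma fourth_power_le_exp:
  fixes y :: real
  assumes "y \<ge> 0"
  shows "y ^ 4 \<le> 65536 * exp (y / 4)"
proof -
  have "y / 16 \<le> exp (y / 16)"
    using exp_ge_add_one_self[of "y / 16"] by linarith
  then have "(y / 16) ^ 4 \<le> exp (y / 16) ^ 4"
    using assms by (intro power_mono) auto
  also have "exp (y / 16) ^ 4 = exp (y / 4)"
    by (simp add: exp_of_nat_mult[symmetric])
  finally show ?thesis
    by (simp add: power_divide)
qed

text \<open>The integral over \<open>\<sigma>\<close> of \<open>((1-\<kappa>) x)\<^sup>2\<close> with the weights that make up the evidence: divided by
  the evidence, it is the posterior expectation of the squared bias caused by shrinkage.\<close>
definition shrinkage_bias :: "real \<Rightarrow> real \<Rightarrow> ennreal" where
  "shrinkage_bias \<tau> x = (\<integral>\<^sup>+\<sigma>. ennreal (normal_density 0 (sqrt (1 + \<sigma>\<^sup>2)) x)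
      * ennreal ((x / (1 + \<sigma>\<^sup>2))\<^sup>2) \<partial>horseshoe_plus_scale \<tau>)"

lemma normal_density_le_exp:
  "normal_density 0 (sqrt (1 + \<sigma>\<^sup>2)) x \<le> exp (- (x\<^sup>2 / (2 * (1 + \<sigma>\<^sup>2))))"
proof -
  have "1 * 1 \<le> (2 * pi) * (1 + \<sigma>\<^sup>2)"
    using pi_ge_two by (intro mult_mono) auto
  then have "1 \<le> sqrt (2 * pi * (1 + \<sigma>\<^sup>2))"
    by (intro real_le_rsqrt) simp
  then have "1 / sqrt (2 * pi * (1 + \<sigma>\<^sup>2)) * exp (- (x\<^sup>2 / (2 * (1 + \<sigma>\<^sup>2)))) \<le> 1 * exp (- (x\<^sup>2 / (2 * (1 + \<sigma>\<^sup>2))))"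
    by (intro mult_right_mono) (auto simp: divide_simps)
  then show ?thesis
    using one_plus_square_pos[of \<sigma>] by (simp add: normal_density_def)
qed

text \<open>If \<open>x\<^sup>2 \<le> 16 K\<^sup>2 L\<close>, the bias is at most \<open>|x|\<close>. Otherwise either \<open>|x|/(1+\<sigma>\<^sup>2) \<le> sqrt L\<close>, and the squared bias is at most
  \<open>L\<close>, or the marginal density at \<open>x\<close> is at most \<open>exp(-|x| sqrt L / 2)\<close>. Half of the last exponent exceeds \<open>K L\<close>
  and pays for the factor \<open>\<tau>\<close> in \<open>evidence_polynomial_lower_bound\<close>; the other half pays for its powers of \<open>x\<close>.
  The constant is \<open>7864320 = 65536 * 120\<close>.\<close>
lemma shrinkage_bias_le:
  fixes K C L :: real
  assumes \<tau>: "0 < \<tau>" "\<tau> \<le> 1" and L: "L \<ge> 1" and K: "K \<ge> 1" and C: "exp (- (K * L)) \<le> C * \<tau>"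
  shows "shrinkage_bias \<tau> x
    \<le> ennreal ((16 * K\<^sup>2 + 1) * L + 7864320 * pi\<^sup>2 * C) * evidence (horseshoe_plus \<tau>) x"
proof -
  have C0: "C \<ge> 0"
    using C \<tau> exp_gt_zero[of "- (K * L)"] by (smt (verit) mult_nonpos_nonneg)
  have scale: "ennreal c * evidence (horseshoe_plus \<tau>) x
      = (\<integral>\<^sup>+\<sigma>. ennreal (normal_density 0 (sqrt (1 + \<sigma>\<^sup>2)) x) * ennreal c \<partial>horseshoe_plus_scale \<tau>)" for c
    unfolding evidence_horseshoe_plus by (subst nn_integral_multc) (auto simp: mult.commute)
  have ratio: "(x / (1 + \<sigma>\<^sup>2))\<^sup>2 \<le> x\<^sup>2" for \<sigma>
  proof -
    have "\<bar>x / (1 + \<sigma>\<^sup>2)\<bar> \<le> \<bar>x\<bar>"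
      using one_plus_square_pos[of \<sigma>] by (simp add: abs_mult divide_simps mult_le_cancel_left1)
    then show ?thesis by (simp only: abs_le_square_iff)
  qed
  show ?thesis
  proof (cases "x\<^sup>2 \<le> 16 * K\<^sup>2 * L")
    case True
    have "shrinkage_bias \<tau> x \<le> ennreal (16 * K\<^sup>2 * L) * evidence (horseshoe_plus \<tau>) x"
      unfolding scale shrinkage_bias_def using True ratio
      by (intro nn_integral_mono mult_left_mono ennreal_leI) (auto intro: order_trans)
    also have "\<dots> \<le> ennreal ((16 * K\<^sup>2 + 1) * L + 7864320 * pi\<^sup>2 * C) * evidence (horseshoe_plus \<tau>) x"
      using L C0 by (intro mult_right_mono ennreal_leI) (auto simp: algebra_simps)
    finally show ?thesis .
  next
    case False
    \<comment> \<open>now \<open>4 K r < y\<close> with \<open>r = sqrt L\<close>, so a quarter of \<open>y r\<close> already exceeds \<open>K L\<close>\<close>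
    define y where "y = \<bar>x\<bar>"
    define r where "r = sqrt L"
    have r: "r \<ge> 1" "r\<^sup>2 = L" using L by (auto simp: r_def)
    have y2: "x\<^sup>2 = y\<^sup>2" "y \<ge> 0" by (auto simp: y_def)
    have y_large: "4 * K * r < y"
    proof (rule power2_less_imp_less)
      show "(4 * K * r)\<^sup>2 < y\<^sup>2" using False r y2 by (simp add: power_mult_distrib)
    qed (use y2 in auto)
    have "1 * 1 \<le> 4 * K * r" using K r by (intro mult_mono) auto
    then have y1: "y \<ge> 1" using y_large by linarith
    have pointwise: "normal_density 0 (sqrt (1 + \<sigma>\<^sup>2)) x * (x / (1 + \<sigma>\<^sup>2))\<^sup>2
        \<le> normal_density 0 (sqrt (1 + \<sigma>\<^sup>2)) x * L + y\<^sup>2 * exp (- (y * r / 2))" for \<sigma>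
    proof (cases "y \<le> r * (1 + \<sigma>\<^sup>2)")
      case True
      then have "y / (1 + \<sigma>\<^sup>2) \<le> r"
        using one_plus_square_pos[of \<sigma>] by (simp add: divide_simps)
      then have "(y / (1 + \<sigma>\<^sup>2))\<^sup>2 \<le> r\<^sup>2"
        using y2 one_plus_square_pos[of \<sigma>] by (intro power_mono) auto
      then have "(x / (1 + \<sigma>\<^sup>2))\<^sup>2 \<le> L"
        using r y2 by (simp add: power_divide)
      then have "normal_density 0 (sqrt (1 + \<sigma>\<^sup>2)) x * (x / (1 + \<sigma>\<^sup>2))\<^sup>2
          \<le> normal_density 0 (sqrt (1 + \<sigma>\<^sup>2)) x * L"
        by (intro mult_left_mono) auto
      then show ?thesis
        by (intro order_trans[OF _ le_add_same_cancel1[THEN iffD2]]) auto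
    next
      case False
      then have "r \<le> y / (1 + \<sigma>\<^sup>2)"
        using one_plus_square_pos[of \<sigma>] by (simp add: pos_le_divide_eq)
      then have "y * r \<le> y * (y / (1 + \<sigma>\<^sup>2))"
        using y2 by (intro mult_left_mono)
      also have "\<dots> = 2 * (x\<^sup>2 / (2 * (1 + \<sigma>\<^sup>2)))"
        using one_plus_square_pos[of \<sigma>] unfolding y2 by (simp add: power2_eq_square divide_simps)
      finally have "y * r / 2 \<le> x\<^sup>2 / (2 * (1 + \<sigma>\<^sup>2))" by linarith
      then have "normal_density 0 (sqrt (1 + \<sigma>\<^sup>2)) x \<le> exp (- (y * r / 2))"
        by (intro order_trans[OF normal_density_le_exp]) simp
      then have "normal_density 0 (sqrt (1 + \<sigma>\<^sup>2)) x * (x / (1 + \<sigma>\<^sup>2))\<^sup>2 \<le> exp (- (y * r / 2)) * y\<^sup>2"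
        using ratio[of \<sigma>] y2 by (intro mult_mono) auto
      then show ?thesis
        using L by (simp add: mult.commute add_increasing)
    qed
    interpret prob_space "horseshoe_plus_scale \<tau>"
      by (rule prob_space_horseshoe_plus_scale) fact
    have "shrinkage_bias \<tau> x \<le> (\<integral>\<^sup>+\<sigma>. ennreal (normal_density 0 (sqrt (1 + \<sigma>\<^sup>2)) x) * ennreal L
        + ennreal (y\<^sup>2 * exp (- (y * r / 2))) \<partial>horseshoe_plus_scale \<tau>)"
      unfolding shrinkage_bias_def
    proof (rule nn_integral_mono)
      fix \<sigma>
      show "ennreal (normal_density 0 (sqrt (1 + \<sigma>\<^sup>2)) x) * ennreal ((x / (1 + \<sigma>\<^sup>2))\<^sup>2)
          \<le> ennreal (normal_density 0 (sqrt (1 + \<sigma>\<^sup>2)) x) * ennreal L + ennreal (y\<^sup>2 * exp (- (y * r / 2)))"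
        using ennreal_leI[OF pointwise[of \<sigma>]] L by (simp add: ennreal_mult ennreal_plus)
    qed
    also have "\<dots> = ennreal L * evidence (horseshoe_plus \<tau>) x + ennreal (y\<^sup>2 * exp (- (y * r / 2)))"
      unfolding scale
      by (subst nn_integral_add) (auto simp: emeasure_space_1[simplified])
    also have "ennreal (y\<^sup>2 * exp (- (y * r / 2))) \<le> ennreal (7864320 * pi\<^sup>2 * C) * evidence (horseshoe_plus \<tau>) x"
    proof -
      have "K * L + y / 4 \<le> y * r / 2"
      proof -
        have "4 * K * r * r \<le> y * r" using y_large r by (intro mult_right_mono) auto
        moreover have "y * 1 \<le> y * r" using r y2 by (intro mult_left_mono) auto
        moreover have "4 * K * r * r = 4 * (K * L)" using r by (simp add: power2_eq_square)
        ultimately show ?thesis by simp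
      qed
      then have "exp (- (y * r / 2)) \<le> exp (- (K * L) + - (y / 4))" by simp
      also have "\<dots> \<le> C * \<tau> * exp (- (y / 4))"
        unfolding exp_add by (intro mult_right_mono C) simp
      finally have "y ^ 4 * exp (- (y * r / 2)) \<le> (65536 * exp (y / 4)) * (C * \<tau> * exp (- (y / 4)))"
        using fourth_power_le_exp[OF y2(2)] by (intro mult_mono) auto
      also have "\<dots> = 65536 * C * \<tau>"
        by (simp add: exp_minus field_simps)
      finally have "y\<^sup>2 * exp (- (y * r / 2)) \<le> 65536 * C * \<tau> / y\<^sup>2"
        using y1 by (simp add: pos_le_divide_eq mult.assoc mult.commute mult.left_commute power2_eq_square power4_eq_xxxx)
      also have "\<dots> = 7864320 * pi\<^sup>2 * C * (\<tau> / (120 * pi\<^sup>2 * x\<^sup>2))"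
        using y1 y2 by simp
      finally have "ennreal (y\<^sup>2 * exp (- (y * r / 2)))
          \<le> ennreal (7864320 * pi\<^sup>2 * C * (\<tau> / (120 * pi\<^sup>2 * x\<^sup>2)))"
        by (rule ennreal_leI)
      also have "\<dots> = ennreal (7864320 * pi\<^sup>2 * C) * ennreal (\<tau> / (120 * pi\<^sup>2 * x\<^sup>2))"
        using C0 \<tau> by (intro ennreal_mult) auto
      also have "\<dots> \<le> ennreal (7864320 * pi\<^sup>2 * C) * evidence (horseshoe_plus \<tau>) x"
        using y1 by (intro mult_left_mono evidence_polynomial_lower_bound \<tau>) (auto simp: y_def)
      finally show ?thesis .
    qed
    also have "ennreal L * evidence (horseshoe_plus \<tau>) x + ennreal (7864320 * pi\<^sup>2 * C) * evidence (horseshoe_plus \<tau>) x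
        = ennreal (L + 7864320 * pi\<^sup>2 * C) * evidence (horseshoe_plus \<tau>) x"
      using L C0 by (simp add: ennreal_plus distrib_right)
    also have "\<dots> \<le> ennreal ((16 * K\<^sup>2 + 1) * L + 7864320 * pi\<^sup>2 * C) * evidence (horseshoe_plus \<tau>) x"
      using L by (intro mult_right_mono ennreal_leI) (auto simp: algebra_simps)
    finally show ?thesis by (simp add: add_left_mono)
  qed
qed

text \<open>The deviation \<open>\<kappa> x - a\<close> is the noise \<open>x - a\<close> minus the bias \<open>(1-\<kappa>) x\<close>.\<close>
lemma weighted_error_le:
  assumes \<tau>: "\<tau> > 0" and D: "D \<ge> 0" "shrinkage_bias \<tau> x \<le> ennreal D * evidence (horseshoe_plus \<tau>) x"
  shows "weighted_error (horseshoe_plus \<tau>) a x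
    \<le> ennreal (1 + 2 * (x - a)\<^sup>2 + 2 * D) * evidence (horseshoe_plus \<tau>) x"
proof -
  have "weighted_error (horseshoe_plus \<tau>) a x
      \<le> (\<integral>\<^sup>+\<sigma>. ennreal (normal_density 0 (sqrt (1 + \<sigma>\<^sup>2)) x) * ennreal (1 + 2 * (x - a)\<^sup>2)
          + 2 * (ennreal (normal_density 0 (sqrt (1 + \<sigma>\<^sup>2)) x) * ennreal ((x / (1 + \<sigma>\<^sup>2))\<^sup>2)) \<partial>horseshoe_plus_scale \<tau>)"
    unfolding weighted_error_horseshoe_plus
  proof (rule nn_integral_mono)
    fix \<sigma>
    have "shrinkage \<sigma> * x - a = (x - a) - (1 - shrinkage \<sigma>) * x"
      by (simp add: algebra_simps)
    also have "\<dots>\<^sup>2 \<le> 2 * (x - a)\<^sup>2 + 2 * ((1 - shrinkage \<sigma>) * x)\<^sup>2"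
      using zero_le_power2[of "(x - a) + (1 - shrinkage \<sigma>) * x"]
      by (simp add: power2_eq_square algebra_simps)
    also have "(1 - shrinkage \<sigma>) * x = x / (1 + \<sigma>\<^sup>2)"
      by (simp add: one_minus_shrinkage)
    finally have "(shrinkage \<sigma> * x - a)\<^sup>2 + shrinkage \<sigma> \<le> (1 + 2 * (x - a)\<^sup>2) + 2 * (x / (1 + \<sigma>\<^sup>2))\<^sup>2"
      using shrinkage_le_1[of \<sigma>] by simp
    then have "normal_density 0 (sqrt (1 + \<sigma>\<^sup>2)) x * ((shrinkage \<sigma> * x - a)\<^sup>2 + shrinkage \<sigma>)
        \<le> normal_density 0 (sqrt (1 + \<sigma>\<^sup>2)) x * (1 + 2 * (x - a)\<^sup>2)
          + 2 * (normal_density 0 (sqrt (1 + \<sigma>\<^sup>2)) x * (x / (1 + \<sigma>\<^sup>2))\<^sup>2)"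
      by (subst mult.left_commute, subst distrib_left[symmetric], intro mult_left_mono) auto
    from ennreal_leI[OF this]
    show "ennreal (normal_density 0 (sqrt (1 + \<sigma>\<^sup>2)) x) * ennreal ((shrinkage \<sigma> * x - a)\<^sup>2 + shrinkage \<sigma>)
        \<le> ennreal (normal_density 0 (sqrt (1 + \<sigma>\<^sup>2)) x) * ennreal (1 + 2 * (x - a)\<^sup>2)
          + 2 * (ennreal (normal_density 0 (sqrt (1 + \<sigma>\<^sup>2)) x) * ennreal ((x / (1 + \<sigma>\<^sup>2))\<^sup>2))"
      by (simp add: ennreal_plus ennreal_mult)
  qed
  also have "\<dots> = ennreal (1 + 2 * (x - a)\<^sup>2) * evidence (horseshoe_plus \<tau>) x + 2 * shrinkage_bias \<tau> x"
    unfolding evidence_horseshoe_plus shrinkage_bias_def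
    by (subst nn_integral_add) (auto simp: nn_integral_multc nn_integral_cmult mult.commute)
  also have "\<dots> \<le> ennreal (1 + 2 * (x - a)\<^sup>2) * evidence (horseshoe_plus \<tau>) x
      + 2 * (ennreal D * evidence (horseshoe_plus \<tau>) x)"
    by (intro add_left_mono mult_left_mono D) simp
  also have "\<dots> = ennreal (1 + 2 * (x - a)\<^sup>2 + 2 * D) * evidence (horseshoe_plus \<tau>) x"
    using D(1) by (subst ennreal_plus) (auto simp: distrib_right ennreal_mult mult.assoc)
  finally show ?thesis .
qed

section \<open>Truncated second moment of the prior scale\<close>

text \<open>The density is at most \<open>2q/(\<pi> \<sigma>\<^sup>2)\<close>, so the integrand is at most \<open>2q/\<pi>\<close> up to \<open>sqrt T\<close> and decays like \<open>T/\<sigma>\<^sup>2\<close>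
  beyond.\<close>
lemma half_cauchy_truncated_second_moment:
  assumes q: "q > 0" and T: "T > 0"
  shows "(\<integral>\<^sup>+\<sigma>. ennreal (half_cauchy_density q \<sigma>) * ennreal (min (\<sigma>\<^sup>2) T) \<partial>lborel) \<le> ennreal (2 * sqrt T * q)"
proof -
  define b where "b = sqrt T"
  have b: "b > 0" "b\<^sup>2 = T" using T by (auto simp: b_def)
  have pointwise: "half_cauchy_density q \<sigma> * min (\<sigma>\<^sup>2) T
      \<le> 2 * q / pi * indicator {0..b} \<sigma> + 2 * q * T / (pi * \<sigma>\<^sup>2) * indicator {b..} \<sigma>" for \<sigma>
  proof (cases "\<sigma> > 0")
    case True
    have pos: "0 < q\<^sup>2 + \<sigma>\<^sup>2" using True by (simp add: add_nonneg_pos)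
    have dens: "half_cauchy_density q \<sigma> \<le> 2 * q / (pi * \<sigma>\<^sup>2)"
      using True q by (auto simp: half_cauchy_density_def intro!: divide_left_mono mult_left_mono mult_pos_pos pos)
    show ?thesis
    proof (cases "\<sigma> \<le> b")
      case le: True
      have "half_cauchy_density q \<sigma> * min (\<sigma>\<^sup>2) T \<le> 2 * q / (pi * \<sigma>\<^sup>2) * \<sigma>\<^sup>2"
        using T q by (intro mult_mono dens) auto
      also have "\<dots> = 2 * q / pi" using True by simp
      also have "\<dots> \<le> 2 * q / pi * indicator {0..b} \<sigma> + 2 * q * T / (pi * \<sigma>\<^sup>2) * indicator {b..} \<sigma>"
        using le True q T by (auto split: split_indicator)
      finally show ?thesis .
    next
      case False
      have "half_cauchy_density q \<sigma> * min (\<sigma>\<^sup>2) T \<le> 2 * q / (pi * \<sigma>\<^sup>2) * T"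
        using T q by (intro mult_mono dens) auto
      then show ?thesis using False by simp
    qed
  next
    case False
    then show ?thesis
      using q T by (auto simp: half_cauchy_density_def split: split_indicator)
  qed
  have tail: "(\<integral>\<^sup>+\<sigma>. ennreal (2 * q * T / (pi * \<sigma>\<^sup>2)) * indicator {b..} \<sigma> \<partial>lborel) = ennreal (0 - (- (2 * q * T / (pi * b))))"
  proof (rule nn_integral_FTC_atLeast)
    show "((\<lambda>\<sigma>. - (2 * q * T / (pi * \<sigma>))) has_real_derivative 2 * q * T / (pi * \<sigma>\<^sup>2)) (at \<sigma>)" if "b \<le> \<sigma>" for \<sigma>
      using that b by (auto intro!: derivative_eq_intros simp: power2_eq_square field_simps)
    have "((\<lambda>\<sigma>. - (2 * q * T / pi) * inverse \<sigma>) \<longlongrightarrow> - (2 * q * T / pi) * 0) at_top"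
      by (intro tendsto_intros tendsto_inverse_0_at_top filterlim_ident)
    then show "((\<lambda>\<sigma>. - (2 * q * T / (pi * \<sigma>))) \<longlongrightarrow> 0) at_top"
      by (simp add: divide_inverse mult.assoc)
  qed (use q T in auto)
  have "(\<integral>\<^sup>+\<sigma>. ennreal (half_cauchy_density q \<sigma>) * ennreal (min (\<sigma>\<^sup>2) T) \<partial>lborel)
      \<le> (\<integral>\<^sup>+\<sigma>. ennreal (2 * q / pi) * indicator {0..b} \<sigma> + ennreal (2 * q * T / (pi * \<sigma>\<^sup>2)) * indicator {b..} \<sigma> \<partial>lborel)"
  proof (rule nn_integral_mono)
    fix \<sigma>
    show "ennreal (half_cauchy_density q \<sigma>) * ennreal (min (\<sigma>\<^sup>2) T)
        \<le> ennreal (2 * q / pi) * indicator {0..b} \<sigma> + ennreal (2 * q * T / (pi * \<sigma>\<^sup>2)) * indicator {b..} \<sigma>"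
    proof -
      have "ennreal (half_cauchy_density q \<sigma>) * ennreal (min (\<sigma>\<^sup>2) T)
          = ennreal (half_cauchy_density q \<sigma> * min (\<sigma>\<^sup>2) T)"
        using T by (subst ennreal_mult) auto
      also have "\<dots> \<le> ennreal (2 * q / pi * indicator {0..b} \<sigma> + 2 * q * T / (pi * \<sigma>\<^sup>2) * indicator {b..} \<sigma>)"
        by (rule ennreal_leI[OF pointwise])
      also have "\<dots> = ennreal (2 * q / pi) * indicator {0..b} \<sigma> + ennreal (2 * q * T / (pi * \<sigma>\<^sup>2)) * indicator {b..} \<sigma>"
        using q T by (subst ennreal_plus) (auto split: split_indicator)
      finally show ?thesis .
    qed
  qed
  also have "\<dots> = ennreal (2 * q / pi) * ennreal b + ennreal (2 * q * T / (pi * b))"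
    using b by (subst nn_integral_add) (simp_all add: tail nn_integral_cmult_indicator)
  also have "\<dots> = ennreal (2 * q / pi * b + 2 * q * T / (pi * b))"
    using q T b by (simp add: ennreal_mult[symmetric] ennreal_plus[symmetric] del: ennreal_plus)
  also have "2 * q / pi * b + 2 * q * T / (pi * b) = 4 * q * b / pi"
    using b by (simp add: b(2)[symmetric] power2_eq_square)
  also have "4 * q * b / pi \<le> 2 * b * q"
  proof -
    have "4 * q * b \<le> 2 * b * q * pi"
      using pi_ge_two q b mult_left_mono[of 2 pi "2 * b * q"] by (simp add: mult_ac)
    then show ?thesis by (simp add: divide_simps)
  qed
  finally show ?thesis by (simp add: b_def ennreal_leI)
qed

text \<open>The bound \<open>2 sqrt T \<tau> \<eta>\<close> for fixed \<open>\<eta>\<close> is not integrable against the half-Cauchy law of \<open>\<eta>\<close>, so beyond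
  \<open>\<eta> = sqrt T / \<tau>\<close>, where it exceeds \<open>T\<close>, the trivial bound \<open>T\<close> replaces it. The logarithm comes from the remaining
  integral of \<open>\<eta>/(1+\<eta>\<^sup>2)\<close>.\<close>
lemma horseshoe_plus_scale_truncated_second_moment:
  assumes \<tau>: "\<tau> > 0" and T: "T > 0"
  shows "(\<integral>\<^sup>+\<sigma>. ennreal (min (\<sigma>\<^sup>2) T) \<partial>horseshoe_plus_scale \<tau>)
    \<le> ennreal (sqrt T * \<tau> * (ln (1 + T / \<tau>\<^sup>2) + 1))"
proof -
  define b where "b = sqrt T"
  have b: "b > 0" "b\<^sup>2 = T" using T by (auto simp: b_def)
  \<comment> \<open>where the two bounds on the inner integral have the same order\<close>
  define R where "R = b / \<tau>"
  have R: "R > 0" using b \<tau> by (simp add: R_def)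
  have body: "(\<integral>\<^sup>+\<eta>. ennreal (4 * b * \<tau> * \<eta> / (pi * (1 + \<eta>\<^sup>2))) * indicator {0..R} \<eta> \<partial>lborel)
      = ennreal (2 * b * \<tau> / pi * ln (1 + R\<^sup>2) - 2 * b * \<tau> / pi * ln (1 + 0\<^sup>2))"
  proof (rule nn_integral_FTC_Icc[where F = "\<lambda>\<eta>. 2 * b * \<tau> / pi * ln (1 + \<eta>\<^sup>2)"])
    show "((\<lambda>\<eta>. 2 * b * \<tau> / pi * ln (1 + \<eta>\<^sup>2)) has_real_derivative 4 * b * \<tau> * \<eta> / (pi * (1 + \<eta>\<^sup>2))) (at \<eta>)" for \<eta>
      using one_plus_square_pos[of \<eta>] by (auto intro!: derivative_eq_intros simp: divide_simps)
    show "0 \<le> 4 * b * \<tau> * \<eta> / (pi * (1 + \<eta>\<^sup>2))" if "\<eta> \<in> {0..R}" for \<eta>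
      using that b \<tau> by (intro divide_nonneg_nonneg mult_nonneg_nonneg add_nonneg_nonneg) auto
  qed (use R in auto)
  have tail: "(\<integral>\<^sup>+\<eta>. ennreal (2 * T / (pi * \<eta>\<^sup>2)) * indicator {R..} \<eta> \<partial>lborel) = ennreal (0 - (- (2 * T / (pi * R))))"
  proof (rule nn_integral_FTC_atLeast)
    show "((\<lambda>\<eta>. - (2 * T / (pi * \<eta>))) has_real_derivative 2 * T / (pi * \<eta>\<^sup>2)) (at \<eta>)" if "R \<le> \<eta>" for \<eta>
      using that R by (auto intro!: derivative_eq_intros simp: power2_eq_square field_simps)
    have "((\<lambda>\<eta>. - (2 * T / pi) * inverse \<eta>) \<longlongrightarrow> - (2 * T / pi) * 0) at_top"
      by (intro tendsto_intros tendsto_inverse_0_at_top filterlim_ident)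
    then show "((\<lambda>\<eta>. - (2 * T / (pi * \<eta>))) \<longlongrightarrow> 0) at_top"
      by (simp add: divide_inverse mult.assoc)
  qed (use T in auto)
  have "(\<integral>\<^sup>+\<sigma>. ennreal (min (\<sigma>\<^sup>2) T) \<partial>horseshoe_plus_scale \<tau>)
      = (\<integral>\<^sup>+\<eta>. ennreal (half_cauchy_density 1 \<eta>)
          * (\<integral>\<^sup>+\<sigma>. ennreal (half_cauchy_density (\<tau> * \<eta>) \<sigma>) * ennreal (min (\<sigma>\<^sup>2) T) \<partial>lborel) \<partial>lborel)"
    by (rule nn_integral_horseshoe_plus_scale) measurable
  also have "\<dots> \<le> (\<integral>\<^sup>+\<eta>. ennreal (4 * b * \<tau> * \<eta> / (pi * (1 + \<eta>\<^sup>2))) * indicator {0..R} \<eta>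
      + ennreal (2 * T / (pi * \<eta>\<^sup>2)) * indicator {R..} \<eta> \<partial>lborel)"
  proof (rule nn_integral_mono)
    fix \<eta> :: real
    define I where "I = (\<integral>\<^sup>+\<sigma>. ennreal (half_cauchy_density (\<tau> * \<eta>) \<sigma>) * ennreal (min (\<sigma>\<^sup>2) T) \<partial>lborel)"
    show "ennreal (half_cauchy_density 1 \<eta>)
          * (\<integral>\<^sup>+\<sigma>. ennreal (half_cauchy_density (\<tau> * \<eta>) \<sigma>) * ennreal (min (\<sigma>\<^sup>2) T) \<partial>lborel)
        \<le> ennreal (4 * b * \<tau> * \<eta> / (pi * (1 + \<eta>\<^sup>2))) * indicator {0..R} \<eta>
          + ennreal (2 * T / (pi * \<eta>\<^sup>2)) * indicator {R..} \<eta>"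
      unfolding I_def[symmetric]
    proof (cases "\<eta> > 0")
      case \<eta>: True
      then have q: "\<tau> * \<eta> > 0" using \<tau> by simp
      show "ennreal (half_cauchy_density 1 \<eta>) * I \<le> ennreal (4 * b * \<tau> * \<eta> / (pi * (1 + \<eta>\<^sup>2))) * indicator {0..R} \<eta>
          + ennreal (2 * T / (pi * \<eta>\<^sup>2)) * indicator {R..} \<eta>"
      proof (cases "\<eta> \<le> R")
        case True
        have "ennreal (half_cauchy_density 1 \<eta>) * I \<le> ennreal (half_cauchy_density 1 \<eta>) * ennreal (2 * b * (\<tau> * \<eta>))"
          unfolding I_def b_def by (intro mult_left_mono half_cauchy_truncated_second_moment q T) simp
        also have "\<dots> = ennreal (4 * b * \<tau> * \<eta> / (pi * (1 + \<eta>\<^sup>2)))"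
          using \<eta> q b \<tau> by (subst ennreal_mult[symmetric]) (auto simp: half_cauchy_density_def mult_ac)
        finally show ?thesis
          using True \<eta> by (simp add: add_increasing2)
      next
        case False
        have "I \<le> (\<integral>\<^sup>+\<sigma>. ennreal (half_cauchy_density (\<tau> * \<eta>) \<sigma>) * ennreal T \<partial>lborel)"
          unfolding I_def by (intro nn_integral_mono mult_left_mono ennreal_leI) auto
        also have "\<dots> = ennreal T"
          using q by (simp add: nn_integral_multc nn_integral_half_cauchy_density)
        finally have "ennreal (half_cauchy_density 1 \<eta>) * I \<le> ennreal (2 / (pi * \<eta>\<^sup>2)) * ennreal T"
          using \<eta> by (intro mult_mono ennreal_leI)
            (auto simp: half_cauchy_density_def intro!: divide_left_mono mult_left_mono mult_pos_pos one_plus_square_pos)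
        also have "\<dots> = ennreal (2 * T / (pi * \<eta>\<^sup>2))"
          using T by (subst ennreal_mult[symmetric]) auto
        finally show ?thesis
          using False by simp
      qed
    qed (simp add: half_cauchy_density_def)
  qed
  also have "\<dots> = ennreal (2 * b * \<tau> / pi * ln (1 + R\<^sup>2)) + ennreal (2 * T / (pi * R))"
    by (subst nn_integral_add) (simp_all add: body tail)
  also have "\<dots> \<le> ennreal (b * \<tau> * ln (1 + T / \<tau>\<^sup>2)) + ennreal (b * \<tau>)"
  proof (intro add_mono ennreal_leI)
    have "R\<^sup>2 = T / \<tau>\<^sup>2" by (simp add: R_def power_divide b)
    moreover have "2 / pi \<le> 1" using pi_ge_two by simp
    moreover have "0 \<le> b * \<tau> * ln (1 + T / \<tau>\<^sup>2)" using b \<tau> T by simp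
    ultimately show "2 * b * \<tau> / pi * ln (1 + R\<^sup>2) \<le> b * \<tau> * ln (1 + T / \<tau>\<^sup>2)"
      using mult_right_mono[of "2 / pi" 1 "b * \<tau> * ln (1 + T / \<tau>\<^sup>2)"] by simp
    have "2 * T / (pi * R) = 2 / pi * (b * \<tau>)"
      using b \<tau> by (simp add: R_def b(2)[symmetric] power2_eq_square)
    then show "2 * T / (pi * R) \<le> b * \<tau>"
      using \<open>2 / pi \<le> 1\<close> b \<tau> mult_right_mono[of "2 / pi" 1 "b * \<tau>"] by simp
  qed
  also have "\<dots> = ennreal (sqrt T * \<tau> * (ln (1 + T / \<tau>\<^sup>2) + 1))"
    using b \<tau> T by (simp add: b_def ennreal_plus[symmetric] distrib_left del: ennreal_plus)
  finally show ?thesis .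
qed

text \<open>For fixed \<open>\<sigma>\<close> the integral over the whole line is \<open>\<sigma>\<^sup>2\<close>, the prior variance of \<open>\<theta>\<close>. On \<open>|x| \<le> t\<close> the conditional posterior
  second moment is at most \<open>1 + t\<^sup>2\<close>.\<close>
lemma nn_integral_weighted_error_truncated:
  assumes \<tau>: "\<tau> > 0" and t: "t \<ge> 0"
  shows "(\<integral>\<^sup>+x. weighted_error (horseshoe_plus \<tau>) 0 x * indicator {-t..t} x \<partial>lborel)
    \<le> (\<integral>\<^sup>+\<sigma>. ennreal (min (\<sigma>\<^sup>2) (1 + t\<^sup>2)) \<partial>horseshoe_plus_scale \<tau>)"
proof -
  interpret H: prob_space "horseshoe_plus_scale \<tau>"
    by (rule prob_space_horseshoe_plus_scale) fact
  interpret pair_sigma_finite "horseshoe_plus_scale \<tau>" lborel ..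
  let ?f = "\<lambda>x \<sigma>. ennreal (normal_density 0 (sqrt (1 + \<sigma>\<^sup>2)) x)
      * ennreal ((shrinkage \<sigma> * x)\<^sup>2 + shrinkage \<sigma>) * indicator {-t..t} x"
  have "(\<integral>\<^sup>+x. weighted_error (horseshoe_plus \<tau>) 0 x * indicator {-t..t} x \<partial>lborel)
      = (\<integral>\<^sup>+x. (\<integral>\<^sup>+\<sigma>. ?f x \<sigma> \<partial>horseshoe_plus_scale \<tau>) \<partial>lborel)"
    unfolding weighted_error_horseshoe_plus
    by (intro nn_integral_cong, subst nn_integral_multc) auto
  also have "\<dots> = (\<integral>\<^sup>+\<sigma>. (\<integral>\<^sup>+x. ?f x \<sigma> \<partial>lborel) \<partial>horseshoe_plus_scale \<tau>)"
    by (rule Fubini') measurable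
  also have "\<dots> \<le> (\<integral>\<^sup>+\<sigma>. ennreal (min (\<sigma>\<^sup>2) (1 + t\<^sup>2)) \<partial>horseshoe_plus_scale \<tau>)"
  proof (rule nn_integral_mono)
    fix \<sigma>
    have s: "sqrt (1 + \<sigma>\<^sup>2) > 0" using one_plus_square_pos[of \<sigma>] by simp
    have \<kappa>: "shrinkage \<sigma> * (1 + \<sigma>\<^sup>2) = \<sigma>\<^sup>2"
      using one_plus_square_pos[of \<sigma>] by (simp add: shrinkage_def)
    have "(\<integral>\<^sup>+x. ?f x \<sigma> \<partial>lborel) \<le> (\<integral>\<^sup>+x. ennreal ((shrinkage \<sigma>)\<^sup>2)
        * (ennreal (normal_density 0 (sqrt (1 + \<sigma>\<^sup>2)) x) * ennreal ((x - 0)\<^sup>2))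
        + ennreal (shrinkage \<sigma>) * ennreal (normal_density 0 (sqrt (1 + \<sigma>\<^sup>2)) x) \<partial>lborel)"
      by (intro nn_integral_mono)
         (auto simp: ennreal_mult[symmetric] ennreal_plus[symmetric] power_mult_distrib distrib_left mult_ac
           simp del: ennreal_plus split: split_indicator)
    also have "\<dots> = ennreal ((shrinkage \<sigma>)\<^sup>2) * ennreal ((sqrt (1 + \<sigma>\<^sup>2))\<^sup>2 + (0 - 0)\<^sup>2) + ennreal (shrinkage \<sigma>) * 1"
      using s by (subst nn_integral_add)
        (simp_all add: nn_integral_cmult nn_integral_normal_density nn_integral_normal_second_moment[where a = 0, simplified])
    also have "\<dots> = ennreal ((shrinkage \<sigma>)\<^sup>2 * (1 + \<sigma>\<^sup>2) + shrinkage \<sigma>)"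
      by (simp add: ennreal_mult ennreal_plus)
    also have "(shrinkage \<sigma>)\<^sup>2 * (1 + \<sigma>\<^sup>2) + shrinkage \<sigma> = \<sigma>\<^sup>2"
      using \<kappa> by (simp add: power2_eq_square[of "shrinkage \<sigma>"] mult.assoc) (simp add: algebra_simps)
    finally have 1: "(\<integral>\<^sup>+x. ?f x \<sigma> \<partial>lborel) \<le> ennreal (\<sigma>\<^sup>2)" .
    have "(\<integral>\<^sup>+x. ?f x \<sigma> \<partial>lborel) \<le> (\<integral>\<^sup>+x. ennreal (normal_density 0 (sqrt (1 + \<sigma>\<^sup>2)) x) * ennreal (1 + t\<^sup>2) \<partial>lborel)"
    proof (rule nn_integral_mono)
      fix x
      have "(shrinkage \<sigma> * x)\<^sup>2 + shrinkage \<sigma> \<le> 1 + t\<^sup>2" if "x \<in> {-t..t}"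
      proof -
        have "\<bar>shrinkage \<sigma> * x\<bar> \<le> 1 * t"
          unfolding abs_mult using that shrinkage_le_1[of \<sigma>] by (intro mult_mono) auto
        then have "(shrinkage \<sigma> * x)\<^sup>2 \<le> t\<^sup>2"
          using t by (simp add: abs_le_square_iff[symmetric])
        then show ?thesis using shrinkage_le_1[of \<sigma>] by simp
      qed
      then show "?f x \<sigma> \<le> ennreal (normal_density 0 (sqrt (1 + \<sigma>\<^sup>2)) x) * ennreal (1 + t\<^sup>2)"
        by (cases "x \<in> {-t..t}") (auto intro!: mult_left_mono ennreal_leI simp del: ennreal_plus)
    qed
    also have "\<dots> = ennreal (1 + t\<^sup>2)"
      using s by (subst nn_integral_multc) (simp_all add: nn_integral_normal_density)
    finally have 2: "(\<integral>\<^sup>+x. ?f x \<sigma> \<partial>lborel) \<le> ennreal (1 + t\<^sup>2)" .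
    show "(\<integral>\<^sup>+x. ?f x \<sigma> \<partial>lborel) \<le> ennreal (min (\<sigma>\<^sup>2) (1 + t\<^sup>2))"
      using 1 2 by (simp add: min_def)
  qed
  finally show ?thesis .
qed

section \<open>Risk of one coordinate\<close>

lemma iid_normal_posterior_horseshoe_plus:
  assumes "0 < \<tau>" "\<tau> \<le> 1"
  shows "iid_normal_posterior (horseshoe_plus \<tau>)"
proof (rule iid_normal_posterior.intro)
  show "subprob_space (horseshoe_plus \<tau>)"
    using assms by (intro subprob_space_horseshoe_plus)
  have "0 < ennreal (normal_density 0 1 x)" for x
    by (simp add: normal_density_pos)
  then have "0 < 8 * evidence (horseshoe_plus \<tau>) x" for x
    using evidence_ge_null_density[OF assms, of x] by (rule less_le_trans)
  then show "0 < evidence (horseshoe_plus \<tau>) x" for x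
    by (simp add: ennreal_zero_less_mult_iff)
qed simp

lemma horseshoe_plus_signal_risk:
  assumes \<tau>: "0 < \<tau>" "\<tau> \<le> 1" and D: "D \<ge> 0"
    and bias: "\<And>x. shrinkage_bias \<tau> x \<le> ennreal D * evidence (horseshoe_plus \<tau>) x"
  shows "(\<integral>\<^sup>+x. ennreal (normal_density a 1 x)
      * (weighted_error (horseshoe_plus \<tau>) a x / evidence (horseshoe_plus \<tau>) x) \<partial>lborel) \<le> ennreal (3 + 2 * D)"
proof -
  interpret iid_normal_posterior "horseshoe_plus \<tau>"
    by (rule iid_normal_posterior_horseshoe_plus) fact+
  have "(\<integral>\<^sup>+x. ennreal (normal_density a 1 x)
      * (weighted_error (horseshoe_plus \<tau>) a x / evidence (horseshoe_plus \<tau>) x) \<partial>lborel)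
    \<le> (\<integral>\<^sup>+x. ennreal (1 + 2 * D) * ennreal (normal_density a 1 x)
        + 2 * (ennreal (normal_density a 1 x) * ennreal ((x - a)\<^sup>2)) \<partial>lborel)"
  proof (rule nn_integral_mono)
    fix x
    have "weighted_error (horseshoe_plus \<tau>) a x / evidence (horseshoe_plus \<tau>) x
        \<le> ennreal (1 + 2 * (x - a)\<^sup>2 + 2 * D)"
      using evidence_pos[of x] evidence_finite[of x]
      by (intro ennreal_ratio_le weighted_error_le \<tau> D bias) auto
    then have "ennreal (normal_density a 1 x) * (weighted_error (horseshoe_plus \<tau>) a x / evidence (horseshoe_plus \<tau>) x)
        \<le> ennreal (normal_density a 1 x) * ennreal (1 + 2 * (x - a)\<^sup>2 + 2 * D)"
      by (rule mult_left_mono) simp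
    also have "\<dots> = ennreal ((1 + 2 * D) * normal_density a 1 x + 2 * (normal_density a 1 x * (x - a)\<^sup>2))"
      using D by (subst ennreal_mult[symmetric]) (auto simp: algebra_simps)
    also have "\<dots> = ennreal (1 + 2 * D) * ennreal (normal_density a 1 x)
        + 2 * (ennreal (normal_density a 1 x) * ennreal ((x - a)\<^sup>2))"
      using D by (subst ennreal_plus) (simp_all add: ennreal_mult)
    finally show "ennreal (normal_density a 1 x)
          * (weighted_error (horseshoe_plus \<tau>) a x / evidence (horseshoe_plus \<tau>) x)
        \<le> ennreal (1 + 2 * D) * ennreal (normal_density a 1 x)
          + 2 * (ennreal (normal_density a 1 x) * ennreal ((x - a)\<^sup>2))" .
  qed
  also have "\<dots> = ennreal (1 + 2 * D) * 1 + 2 * ennreal (1\<^sup>2 + (a - a)\<^sup>2)"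
    by (subst nn_integral_add)
       (simp_all add: nn_integral_cmult nn_integral_normal_density nn_integral_normal_second_moment del: ennreal_plus)
  also have "\<dots> = ennreal ((1 + 2 * D) + 2)"
    using D by (subst ennreal_plus[of "1 + 2 * D" 2]) (auto simp del: ennreal_plus)
  finally show ?thesis
    by (simp add: algebra_simps)
qed

lemma weighted_error_null_le:
  assumes "\<tau> > 0"
  shows "weighted_error (horseshoe_plus \<tau>) 0 x \<le> ennreal (1 + x\<^sup>2) * evidence (horseshoe_plus \<tau>) x"
proof -
  have "(shrinkage \<sigma> * x - 0)\<^sup>2 + shrinkage \<sigma> \<le> 1 + x\<^sup>2" for \<sigma>
  proof -
    have "\<bar>shrinkage \<sigma> * x\<bar> \<le> 1 * \<bar>x\<bar>"
      unfolding abs_mult using shrinkage_le_1[of \<sigma>] by (intro mult_right_mono) auto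
    then have "(shrinkage \<sigma> * x)\<^sup>2 \<le> x\<^sup>2"
      by (simp add: abs_le_square_iff[symmetric])
    then show ?thesis using shrinkage_le_1[of \<sigma>] by simp
  qed
  then have "weighted_error (horseshoe_plus \<tau>) 0 x
      \<le> (\<integral>\<^sup>+\<sigma>. ennreal (normal_density 0 (sqrt (1 + \<sigma>\<^sup>2)) x) * ennreal (1 + x\<^sup>2) \<partial>horseshoe_plus_scale \<tau>)"
    unfolding weighted_error_horseshoe_plus
    by (intro nn_integral_mono mult_left_mono ennreal_leI) auto
  also have "\<dots> = ennreal (1 + x\<^sup>2) * evidence (horseshoe_plus \<tau>) x"
    unfolding evidence_horseshoe_plus by (subst nn_integral_multc) (auto simp: mult.commute simp del: ennreal_plus)
  finally show ?thesis .
qed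

lemma std_normal_density_tail:
  assumes "t\<^sup>2 \<le> x\<^sup>2"
  shows "normal_density 0 1 x \<le> sqrt 2 * exp (- (t\<^sup>2 / 4)) * normal_density 0 (sqrt 2) x"
proof -
  have "normal_density 0 1 x = sqrt 2 * normal_density 0 (sqrt 2) x * exp (- (x\<^sup>2 / 4))"
  proof -
    have "exp (- (x\<^sup>2 / 2)) = exp (- (x\<^sup>2 / 4)) * exp (- (x\<^sup>2 / 4))"
      by (simp add: mult_exp_exp)
    moreover have "1 / sqrt (2 * pi) = sqrt 2 * (1 / sqrt (2 * pi * 2))"
      unfolding real_sqrt_mult[of "2 * pi" 2] by (simp del: real_sqrt_mult)
    ultimately show ?thesis
      by (simp add: normal_density_def)
  qed
  also have "\<dots> \<le> sqrt 2 * normal_density 0 (sqrt 2) x * exp (- (t\<^sup>2 / 4))"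
    using assms by (intro mult_left_mono) auto
  finally show ?thesis by (simp add: mult_ac)
qed

text \<open>On \<open>|x| \<le> t\<close> the evidence in the denominator cancels against the standard normal density. On \<open>|x| > t\<close> the posterior
  second moment is at most \<open>1 + x\<^sup>2\<close>; half of the Gaussian exponent gives the factor \<open>exp(-t\<^sup>2/4)\<close>, the other half makes the
  integral converge.\<close>
lemma horseshoe_plus_noise_risk:
  assumes \<tau>: "0 < \<tau>" "\<tau> \<le> 1" and t: "t \<ge> 0"
  shows "(\<integral>\<^sup>+x. ennreal (normal_density 0 1 x)
      * (weighted_error (horseshoe_plus \<tau>) 0 x / evidence (horseshoe_plus \<tau>) x) \<partial>lborel)
    \<le> ennreal (8 * (sqrt (1 + t\<^sup>2) * \<tau> * (ln (1 + (1 + t\<^sup>2) / \<tau>\<^sup>2) + 1)) + 6 * exp (- (t\<^sup>2 / 4)))"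
proof -
  interpret iid_normal_posterior "horseshoe_plus \<tau>"
    by (rule iid_normal_posterior_horseshoe_plus) fact+
  let ?w = "weighted_error (horseshoe_plus \<tau>) 0" and ?e = "evidence (horseshoe_plus \<tau>)"
  define c where "c = sqrt 2 * exp (- (t\<^sup>2 / 4))"
  have c: "c \<ge> 0" by (simp add: c_def)
  have "(\<integral>\<^sup>+x. ennreal (normal_density 0 1 x) * (?w x / ?e x) \<partial>lborel)
      \<le> (\<integral>\<^sup>+x. 8 * (?w x * indicator {-t..t} x)
          + ennreal c * (ennreal (normal_density 0 (sqrt 2) x)
            + ennreal (normal_density 0 (sqrt 2) x) * ennreal ((x - 0)\<^sup>2)) \<partial>lborel)"
  proof (rule nn_integral_mono)
    fix x
    have e: "?e x \<noteq> 0" "?e x \<noteq> top"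
      using evidence_pos[of x] evidence_finite[of x] by auto
    show "ennreal (normal_density 0 1 x) * (?w x / ?e x)
        \<le> 8 * (?w x * indicator {-t..t} x)
          + ennreal c * (ennreal (normal_density 0 (sqrt 2) x)
            + ennreal (normal_density 0 (sqrt 2) x) * ennreal ((x - 0)\<^sup>2))"
    proof (cases "x \<in> {-t..t}")
      case True
      have "ennreal (normal_density 0 1 x) * (?w x / ?e x) \<le> (8 * ?e x) * (?w x / ?e x)"
        by (intro mult_right_mono evidence_ge_null_density \<tau>) simp
      also have "\<dots> = 8 * (?w x * ?e x / ?e x)"
        by (simp add: ennreal_times_divide mult.assoc mult.commute[of "?e x"])
      also have "\<dots> = 8 * ?w x"
        using e by (simp add: ennreal_mult_divide_eq)
      finally show ?thesis using True by (simp add: add_increasing2)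
    next
      case False
      then have "\<bar>t\<bar> \<le> \<bar>x\<bar>" using t by auto
      then have tx: "t\<^sup>2 \<le> x\<^sup>2" by (simp only: abs_le_square_iff)
      have "?w x / ?e x \<le> ennreal (1 + x\<^sup>2)"
        using e \<tau> by (intro ennreal_ratio_le weighted_error_null_le) auto
      then have "ennreal (normal_density 0 1 x) * (?w x / ?e x)
          \<le> ennreal (c * normal_density 0 (sqrt 2) x) * ennreal (1 + x\<^sup>2)"
        unfolding c_def by (intro mult_mono ennreal_leI std_normal_density_tail tx) auto
      also have "\<dots> = ennreal c * (ennreal (normal_density 0 (sqrt 2) x)
            + ennreal (normal_density 0 (sqrt 2) x) * ennreal ((x - 0)\<^sup>2))"
        using c by (simp add: ennreal_mult distrib_left mult.assoc)
      finally show ?thesis by (simp add: add_increasing)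
    qed
  qed
  also have "\<dots> = 8 * (\<integral>\<^sup>+x. ?w x * indicator {-t..t} x \<partial>lborel) + ennreal c * (1 + ennreal ((sqrt 2)\<^sup>2 + (0 - 0)\<^sup>2))"
    by (subst nn_integral_add, simp, simp, subst nn_integral_cmult, simp, subst nn_integral_cmult, simp,
        subst nn_integral_add, simp, simp)
       (simp only: nn_integral_normal_density nn_integral_normal_second_moment real_sqrt_gt_zero zero_less_numeral)
  also have "\<dots> \<le> 8 * ennreal (sqrt (1 + t\<^sup>2) * \<tau> * (ln (1 + (1 + t\<^sup>2) / \<tau>\<^sup>2) + 1)) + ennreal (6 * exp (- (t\<^sup>2 / 4)))"
  proof (intro add_mono mult_left_mono)
    show "(\<integral>\<^sup>+x. ?w x * indicator {-t..t} x \<partial>lborel)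
        \<le> ennreal (sqrt (1 + t\<^sup>2) * \<tau> * (ln (1 + (1 + t\<^sup>2) / \<tau>\<^sup>2) + 1))"
      using nn_integral_weighted_error_truncated[OF \<tau>(1) t]
        horseshoe_plus_scale_truncated_second_moment[OF \<tau>(1), of "1 + t\<^sup>2"] one_plus_square_pos[of t]
      by (meson order_trans)
    have "1 + ennreal ((sqrt 2)\<^sup>2 + (0 - 0)\<^sup>2) = ennreal 3"
      by simp
    then have "ennreal c * (1 + ennreal ((sqrt 2)\<^sup>2 + (0 - 0)\<^sup>2)) = ennreal (c * 3)"
      using c by (simp only: ennreal_mult)
    also have "c * 3 \<le> 6 * exp (- (t\<^sup>2 / 4))"
      unfolding c_def using real_sqrt_le_mono[of 2 4] by simp
    finally show "ennreal c * (1 + ennreal ((sqrt 2)\<^sup>2 + (0 - 0)\<^sup>2)) \<le> ennreal (6 * exp (- (t\<^sup>2 / 4)))"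
      by (simp add: ennreal_leI)
  qed simp
  also have "\<dots> = ennreal (8 * (sqrt (1 + t\<^sup>2) * \<tau> * (ln (1 + (1 + t\<^sup>2) / \<tau>\<^sup>2) + 1)) + 6 * exp (- (t\<^sup>2 / 4)))"
  proof -
    have "0 \<le> sqrt (1 + t\<^sup>2) * \<tau> * (ln (1 + (1 + t\<^sup>2) / \<tau>\<^sup>2) + 1)"
      using \<tau> by (intro mult_nonneg_nonneg add_nonneg_nonneg ln_ge_zero) auto
    then show ?thesis
      by (subst ennreal_plus) (simp_all add: ennreal_mult' del: ennreal_plus)
  qed
  finally show ?thesis .
qed

section \<open>Rates and total risk\<close>

text \<open>The lower bound on \<open>\<tau>\<close> makes \<open>log(1/\<tau>)\<close> of order \<open>L\<close>. The upper bound makes \<open>sqrt L * \<tau>\<close> of order \<open>exp (- L)\<close>.\<close>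
lemma noise_rate:
  fixes L K C\<^sub>1 C\<^sub>2 \<tau> :: real
  assumes L: "L \<ge> 1" and K: "K \<ge> 0" and \<tau>: "0 < \<tau>" "\<tau> \<le> 1" and C: "C\<^sub>1 \<ge> 1" "C\<^sub>2 \<ge> 0"
    and lower: "exp (- (K * L)) \<le> C\<^sub>1 * \<tau>"
    and upper: "\<tau> \<le> C\<^sub>2 * (exp (- L) * L powr (-1/2))"
  shows "8 * (sqrt (1 + 4 * L) * \<tau> * (ln (1 + (1 + 4 * L) / \<tau>\<^sup>2) + 1)) + 6 * exp (- L)
    \<le> (24 * C\<^sub>2 * (ln 6 + 2 * ln C\<^sub>1 + 2 * K + 2) + 6) * (exp (- L) * L)"
proof -
  define Q where "Q = ln 6 + 2 * ln C\<^sub>1 + 2 * K + 2"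
  have Q0: "Q \<ge> 0" using C K by (simp add: Q_def)
  have "exp (- (K * L)) / C\<^sub>1 \<le> \<tau>"
    using lower C by (simp add: divide_simps mult.commute)
  then have "ln (exp (- (K * L)) / C\<^sub>1) \<le> ln \<tau>"
    using C \<tau> by (subst ln_le_cancel_iff) auto
  then have ln_tau: "- ln \<tau> \<le> K * L + ln C\<^sub>1"
    using C by (simp add: ln_div)
  have "1 + (1 + 4 * L) / \<tau>\<^sup>2 \<le> 6 * L / \<tau>\<^sup>2"
  proof -
    have "\<tau>\<^sup>2 \<le> 1" using \<tau> by (simp add: power_le_one)
    then have "\<tau>\<^sup>2 + (1 + 4 * L) \<le> 6 * L" using L by simp
    then have "(\<tau>\<^sup>2 + (1 + 4 * L)) / \<tau>\<^sup>2 \<le> 6 * L / \<tau>\<^sup>2" by (intro divide_right_mono) auto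
    then show ?thesis using \<tau> by (simp add: add_divide_distrib)
  qed
  then have "ln (1 + (1 + 4 * L) / \<tau>\<^sup>2) \<le> ln (6 * L / \<tau>\<^sup>2)"
    using L \<tau> by (subst ln_le_cancel_iff) (auto intro!: add_pos_nonneg)
  also have "\<dots> = ln 6 + ln L - 2 * ln \<tau>"
    using L \<tau> by (simp add: ln_div ln_mult ln_realpow)
  also have "\<dots> \<le> ln 6 + L + 2 * (K * L + ln C\<^sub>1)"
  proof -
    have "ln L < L" using L by (intro ln_less_self) simp
    moreover have "2 * (- ln \<tau>) \<le> 2 * (K * L + ln C\<^sub>1)"
      by (intro mult_left_mono ln_tau) simp
    moreover have "2 * (- ln \<tau>) = - (2 * ln \<tau>)"
      by simp
    ultimately show ?thesis by linarith
  qed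
  also have "\<dots> \<le> (ln 6 + 2 * ln C\<^sub>1) * L + L + 2 * K * L"
    using C L mult_left_mono[of 1 L "ln 6 + 2 * ln C\<^sub>1"] by (simp add: algebra_simps)
  finally have log: "ln (1 + (1 + 4 * L) / \<tau>\<^sup>2) + 1 \<le> Q * L"
    using L by (simp add: Q_def algebra_simps)
  have "sqrt (1 + 4 * L) \<le> sqrt (9 * L)" using L by simp
  also have "\<dots> = 3 * sqrt L" by (simp add: real_sqrt_mult)
  finally have "sqrt (1 + 4 * L) * \<tau> \<le> 3 * sqrt L * (C\<^sub>2 * (exp (- L) * L powr (-1/2)))"
    using L \<tau> by (intro mult_mono upper) auto
  also have "\<dots> = 3 * C\<^sub>2 * exp (- L)"
  proof -
    have "sqrt L * L powr (-1/2) = 1"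
      using L by (simp add: powr_half_sqrt[symmetric] powr_add[symmetric])
    then show ?thesis
      by (metis (no_types, opaque_lifting) mult.assoc mult.commute mult.right_neutral)
  qed
  finally have root: "sqrt (1 + 4 * L) * \<tau> \<le> 3 * C\<^sub>2 * exp (- L)" .
  have "0 \<le> ln (1 + (1 + 4 * L) / \<tau>\<^sup>2) + 1"
    using L by (intro add_nonneg_nonneg ln_ge_zero) auto
  then have "sqrt (1 + 4 * L) * \<tau> * (ln (1 + (1 + 4 * L) / \<tau>\<^sup>2) + 1) \<le> 3 * C\<^sub>2 * exp (- L) * (Q * L)"
    using C by (intro mult_mono root log) auto
  moreover have "exp (- L) * 1 \<le> exp (- L) * L"
    using L by (intro mult_left_mono) auto
  ultimately have "8 * (sqrt (1 + 4 * L) * \<tau> * (ln (1 + (1 + 4 * L) / \<tau>\<^sup>2) + 1)) + 6 * exp (- L)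
      \<le> 8 * (3 * C\<^sub>2 * exp (- L) * (Q * L)) + 6 * (exp (- L) * L)"
    by (intro add_mono mult_left_mono) simp_all
  also have "\<dots> = (24 * C\<^sub>2 * Q + 6) * (exp (- L) * L)"
    by (simp add: algebra_simps)
  finally show ?thesis
    by (simp only: Q_def)
qed

text \<open>There are at most \<open>n\<close> noise coordinates with risk of order \<open>p/n\<close> each, and at most \<open>p\<close> signal coordinates.\<close>
lemma sparse_total_risk:
  assumes \<nu>: "iid_normal_posterior \<nu>" and n: "n \<ge> 1" and p: "p > 0"
    and rates: "c\<^sub>0 \<ge> 0" "c\<^sub>1 \<ge> 0"
    and noise: "(\<integral>\<^sup>+x. ennreal (normal_density 0 1 x) * (weighted_error \<nu> 0 x / evidence \<nu> x) \<partial>lborel) \<le> ennreal (c\<^sub>0 * (p / n))"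
    and signal: "\<And>a. (\<integral>\<^sup>+x. ennreal (normal_density a 1 x) * (weighted_error \<nu> a x / evidence \<nu> x) \<partial>lborel) \<le> ennreal c\<^sub>1"
    and \<theta>: "\<theta>\<^sub>0 \<in> sparse_vectors n p"
  shows "(\<integral>\<^sup>+x. iid_normal_posterior.risk_sum \<nu> n \<theta>\<^sub>0 x \<partial>sample_law n \<theta>\<^sub>0) \<le> ennreal ((c\<^sub>0 + c\<^sub>1) * p)"
proof -
  interpret iid_normal_posterior \<nu> n by (rule \<nu>)
  have "(\<integral>\<^sup>+x. risk_sum \<theta>\<^sub>0 x \<partial>sample_law n \<theta>\<^sub>0)
      \<le> (\<Sum>i=1..n. ennreal (c\<^sub>0 * (p / n) + c\<^sub>1 * of_bool (\<theta>\<^sub>0 i \<noteq> 0)))"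
    unfolding nn_integral_risk_sum
  proof (rule sum_mono)
    fix i
    show "(\<integral>\<^sup>+x. ennreal (normal_density (\<theta>\<^sub>0 i) 1 x) * (weighted_error \<nu> (\<theta>\<^sub>0 i) x / evidence \<nu> x) \<partial>lborel)
        \<le> ennreal (c\<^sub>0 * (p / n) + c\<^sub>1 * of_bool (\<theta>\<^sub>0 i \<noteq> 0))"
    proof (cases "\<theta>\<^sub>0 i = 0")
      case True
      then show ?thesis using noise by simp
    next
      case False
      have "ennreal c\<^sub>1 \<le> ennreal (c\<^sub>0 * (p / n) + c\<^sub>1 * of_bool (\<theta>\<^sub>0 i \<noteq> 0))"
        using False p rates by (intro ennreal_leI) simp
      then show ?thesis using signal order_trans by blast
    qed
  qed
  also have "\<dots> = ennreal (\<Sum>i=1..n. c\<^sub>0 * (p / n) + c\<^sub>1 * of_bool (\<theta>\<^sub>0 i \<noteq> 0))"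
    using p rates by (intro sum_ennreal) auto
  also have "\<dots> \<le> ennreal ((c\<^sub>0 + c\<^sub>1) * p)"
  proof (rule ennreal_leI)
    have "(\<Sum>i=1..n. c\<^sub>0 * (p / n) + c\<^sub>1 * of_bool (\<theta>\<^sub>0 i \<noteq> 0)) = c\<^sub>0 * p + c\<^sub>1 * (\<Sum>i=1..n. of_bool (\<theta>\<^sub>0 i \<noteq> 0))"
      using n by (simp only: sum.distrib sum_distrib_left[symmetric]) simp
    also have "\<dots> \<le> c\<^sub>0 * p + c\<^sub>1 * p"
      using \<theta> rates by (intro add_left_mono mult_left_mono) (auto simp: sparse_vectors_def)
    finally show "(\<Sum>i=1..n. c\<^sub>0 * (p / n) + c\<^sub>1 * of_bool (\<theta>\<^sub>0 i \<noteq> 0)) \<le> (c\<^sub>0 + c\<^sub>1) * p"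
      by (simp add: distrib_right)
  qed
  finally show ?thesis .
qed

theorem mainTheorem4:
  fixes p \<tau> :: "nat \<Rightarrow> real" and K :: real
  assumes p_range: "\<And>n. n \<ge> 1 \<Longrightarrow> 0 < p n \<and> p n < real n"
    and p_small: "p \<in> o(\<lambda>n. real n)"
    and tau_pos: "\<And>n. n \<ge> 1 \<Longrightarrow> \<tau> n > 0"
    and K: "K > 1"
    and tau_lower: "\<exists>C. \<forall>\<^sub>F n in sequentially. (p n / real n) powr K \<le> C * \<tau> n"
    and tau_upper: "\<exists>C. \<forall>\<^sub>F n in sequentially.
          \<tau> n \<le> C * (p n / real n * ln (real n / p n) powr (-1/2))"
  shows
    "(\<forall>n\<ge>1. distr (horseshoe_plus_scale (\<tau> n)) borel (\<lambda>\<sigma>. \<sigma>\<^sup>2) =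
        density lborel (\<lambda>u. ennreal (horseshoe_plus_mixing_density (\<tau> n) u)))
   \<and> (\<forall>M :: nat \<Rightarrow> real. (\<forall>n\<ge>1. M n > 0) \<longrightarrow> filterlim M at_top sequentially \<longrightarrow>
        (\<lambda>n. SUP \<theta>\<^sub>0\<in>sparse_vectors n (p n).
           \<integral>\<^sup>+x. emeasure (posterior n (iid_prior n (horseshoe_plus (\<tau> n))) x)
                 {\<theta> \<in> euclidean_points n. sq_dist n \<theta> \<theta>\<^sub>0 > M n * p n * ln (real n / p n)}
             \<partial>sample_law n \<theta>\<^sub>0) \<longlonglongrightarrow> 0)
   \<and> (\<exists>C :: real. \<forall>\<^sub>F n in sequentially.
        (SUP \<theta>\<^sub>0\<in>sparse_vectors n (p n).
           \<integral>\<^sup>+x. ennreal (sq_dist n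
                 (posterior_mean n (iid_prior n (horseshoe_plus (\<tau> n))) x) \<theta>\<^sub>0)
             \<partial>sample_law n \<theta>\<^sub>0)
        \<le> ennreal (C * (p n * ln (real n / p n))))"
proof -
  define s where "s n = p n / real n" for n
  define L where "L n = ln (real n / p n)" for n
  define Loss where "Loss n \<theta>\<^sub>0 = (\<integral>\<^sup>+x. iid_normal_posterior.risk_sum (horseshoe_plus (\<tau> n)) n \<theta>\<^sub>0 x \<partial>sample_law n \<theta>\<^sub>0)" for n \<theta>\<^sub>0
  obtain A where A: "\<forall>\<^sub>F n in sequentially. (p n / real n) powr K \<le> A * \<tau> n"
    using tau_lower by blast
  obtain B where B: "\<forall>\<^sub>F n in sequentially. \<tau> n \<le> B * (p n / real n * ln (real n / p n) powr (-1/2))"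
    using tau_upper by blast
  \<comment> \<open>the given constants may be negative or small; the estimates need \<open>C\<^sub>1 \<ge> 1\<close> and \<open>C\<^sub>2 \<ge> 0\<close>\<close>
  define C\<^sub>1 where "C\<^sub>1 = max A 1"
  define C\<^sub>2 where "C\<^sub>2 = max B 0"
  have C: "C\<^sub>1 \<ge> 1" "C\<^sub>2 \<ge> 0" by (simp_all add: C\<^sub>1_def C\<^sub>2_def)
  define c\<^sub>0 where "c\<^sub>0 = 24 * C\<^sub>2 * (ln 6 + 2 * ln C\<^sub>1 + 2 * K + 2) + 6"
  define c\<^sub>1 where "c\<^sub>1 = 3 + 2 * (16 * K\<^sup>2 + 1 + 7864320 * pi\<^sup>2 * C\<^sub>1)"
  have c: "c\<^sub>0 \<ge> 0" "c\<^sub>1 \<ge> 0"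
    using C K by (auto simp: c\<^sub>0_def c\<^sub>1_def)
  \<comment> \<open>sparsity \<open>p/n\<close> below this threshold ensures both \<open>L \<ge> 1\<close> and \<open>\<tau> \<le> 1\<close>\<close>
  define \<epsilon> where "\<epsilon> = min (exp (- 1)) (1 / (C\<^sub>2 + 1))"
  have \<epsilon>: "\<epsilon> > 0" using C by (simp add: \<epsilon>_def)
  have small: "\<forall>\<^sub>F n in sequentially. norm (p n) \<le> \<epsilon> * norm (real n)"
    using p_small \<epsilon> by (rule landau_o.smallD)
  have regime: "\<forall>\<^sub>F n in sequentially. n \<ge> 1 \<and> L n \<ge> 1 \<and> s n = exp (- L n) \<and> 0 < p n \<and> 0 < \<tau> n \<and> \<tau> n \<le> 1
      \<and> exp (- (K * L n)) \<le> C\<^sub>1 * \<tau> n \<and> \<tau> n \<le> C\<^sub>2 * (exp (- L n) * L n powr (-1/2))"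
    using small A B eventually_ge_at_top[of "1::nat"]
  proof eventually_elim
    case (elim n)
    have p: "0 < p n" "p n < real n" and \<tau>: "0 < \<tau> n"
      using elim p_range tau_pos by auto
    have n: "real n > 0" using elim by simp
    have s_le: "s n \<le> \<epsilon>"
      using elim p n by (simp add: s_def divide_simps)
    have s0: "s n > 0" using p n by (simp add: s_def)
    have s_exp: "s n = exp (- L n)"
      using p n by (simp add: s_def L_def exp_minus)
    have "exp (- L n) \<le> exp (- 1)"
      using s_le by (simp add: s_exp \<epsilon>_def)
    then have L1: "L n \<ge> 1" by simp
    have "exp (- (K * L n)) = s n powr K"
      by (simp add: s_exp powr_def)
    also have "\<dots> \<le> A * \<tau> n" using elim by (simp add: s_def)
    also have "\<dots> \<le> C\<^sub>1 * \<tau> n" using \<tau> by (intro mult_right_mono) (auto simp: C\<^sub>1_def)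
    finally have lower: "exp (- (K * L n)) \<le> C\<^sub>1 * \<tau> n" .
    have "\<tau> n \<le> B * (s n * L n powr (-1/2))" using elim by (simp add: s_def L_def)
    also have "\<dots> \<le> C\<^sub>2 * (s n * L n powr (-1/2))"
      using s0 by (intro mult_right_mono) (auto simp: C\<^sub>2_def)
    finally have upper: "\<tau> n \<le> C\<^sub>2 * (s n * L n powr (-1/2))" .
    also have "\<dots> \<le> C\<^sub>2 * (1 / (C\<^sub>2 + 1) * 1)"
    proof (intro mult_left_mono mult_mono C)
      show "s n \<le> 1 / (C\<^sub>2 + 1)" using s_le by (simp add: \<epsilon>_def)
      show "L n powr (-1/2) \<le> 1" using L1 powr_mono[of "-1/2" 0 "L n"] by simp
    qed (use C in auto)
    also have "\<dots> \<le> 1" using C by (simp add: divide_simps)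
    finally show ?case
      using elim p \<tau> L1 s_exp lower upper by simp
  qed
  have risk: "\<forall>\<^sub>F n in sequentially. iid_normal_posterior (horseshoe_plus (\<tau> n)) \<and> 0 < p n * L n \<and>
      (\<forall>\<theta>\<^sub>0\<in>sparse_vectors n (p n). Loss n \<theta>\<^sub>0 \<le> ennreal ((c\<^sub>0 + c\<^sub>1) * (p n * L n)))"
    using regime
  proof eventually_elim
    case (elim n)
    then have L: "L n \<ge> 1" and p: "p n > 0" and n: "n \<ge> 1" and \<tau>: "0 < \<tau> n" "\<tau> n \<le> 1" and s: "s n = exp (- L n)"
      and lower: "exp (- (K * L n)) \<le> C\<^sub>1 * \<tau> n"
      and upper: "\<tau> n \<le> C\<^sub>2 * (exp (- L n) * L n powr (-1/2))"
      by auto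
    have post: "iid_normal_posterior (horseshoe_plus (\<tau> n))"
      using \<tau> by (rule iid_normal_posterior_horseshoe_plus)
    \<comment> \<open>the cut-off \<open>t = 2 sqrt L\<close> makes \<open>exp(-t\<^sup>2/4)\<close> equal to \<open>p/n\<close>\<close>
    have t: "(2 * sqrt (L n))\<^sup>2 = 4 * L n" using L by (simp add: power_mult_distrib)
    have noise: "(\<integral>\<^sup>+x. ennreal (normal_density 0 1 x)
        * (weighted_error (horseshoe_plus (\<tau> n)) 0 x / evidence (horseshoe_plus (\<tau> n)) x) \<partial>lborel)
      \<le> ennreal (c\<^sub>0 * L n * (p n / n))"
    proof -
      have "8 * (sqrt (1 + 4 * L n) * \<tau> n * (ln (1 + (1 + 4 * L n) / (\<tau> n)\<^sup>2) + 1)) + 6 * exp (- L n)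
          \<le> c\<^sub>0 * (exp (- L n) * L n)"
        unfolding c\<^sub>0_def using K by (intro noise_rate L \<tau> C lower upper) simp
      also have "\<dots> = c\<^sub>0 * L n * (p n / n)"
        using s by (simp add: s_def)
      finally show ?thesis
        using horseshoe_plus_noise_risk[OF \<tau>, of "2 * sqrt (L n)"] L
        unfolding t by (simp add: order_trans[OF _ ennreal_leI])
    qed
    have signal: "(\<integral>\<^sup>+x. ennreal (normal_density a 1 x)
        * (weighted_error (horseshoe_plus (\<tau> n)) a x / evidence (horseshoe_plus (\<tau> n)) x) \<partial>lborel)
      \<le> ennreal (c\<^sub>1 * L n)" for a
    proof -
      define D where "D = (16 * K\<^sup>2 + 1) * L n + 7864320 * pi\<^sup>2 * C\<^sub>1"
      have "D \<ge> 0" using C L by (simp add: D_def)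
      then have "(\<integral>\<^sup>+x. ennreal (normal_density a 1 x)
          * (weighted_error (horseshoe_plus (\<tau> n)) a x / evidence (horseshoe_plus (\<tau> n)) x) \<partial>lborel)
        \<le> ennreal (3 + 2 * D)"
        unfolding D_def using K by (intro horseshoe_plus_signal_risk \<tau> shrinkage_bias_le L lower) auto
      also have "3 + 2 * D \<le> c\<^sub>1 * L n"
      proof -
        have "(3 + 2 * (7864320 * pi\<^sup>2 * C\<^sub>1)) * 1 \<le> (3 + 2 * (7864320 * pi\<^sup>2 * C\<^sub>1)) * L n"
          using C L by (intro mult_left_mono) auto
        then show ?thesis by (simp add: D_def c\<^sub>1_def algebra_simps)
      qed
      finally show ?thesis by (simp add: ennreal_leI)
    qed
    have "Loss n \<theta>\<^sub>0 \<le> ennreal ((c\<^sub>0 * L n + c\<^sub>1 * L n) * p n)" if "\<theta>\<^sub>0 \<in> sparse_vectors n (p n)" for \<theta>\<^sub>0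
      unfolding Loss_def using L c by (intro sparse_total_risk post n p noise signal that) auto
    then show ?case
      using post p L by (simp add: algebra_simps)
  qed
  show ?thesis
  proof (intro conjI allI impI)
    fix n :: nat assume "1 \<le> n"
    then show "distr (horseshoe_plus_scale (\<tau> n)) borel (\<lambda>\<sigma>. \<sigma>\<^sup>2) =
        density lborel (\<lambda>u. ennreal (horseshoe_plus_mixing_density (\<tau> n) u))"
      by (intro distr_square_horseshoe_plus_scale tau_pos)
  next
    fix M :: "nat \<Rightarrow> real"
    assume M: "\<forall>n\<ge>1. 0 < M n" "filterlim M at_top sequentially"
    let ?tail = "\<lambda>n. SUP \<theta>\<^sub>0\<in>sparse_vectors n (p n).
           \<integral>\<^sup>+x. emeasure (posterior n (iid_prior n (horseshoe_plus (\<tau> n))) x)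
                 {\<theta> \<in> euclidean_points n. sq_dist n \<theta> \<theta>\<^sub>0 > M n * p n * ln (real n / p n)}
             \<partial>sample_law n \<theta>\<^sub>0"
    have bound: "\<forall>\<^sub>F n in sequentially. ?tail n \<le> ennreal ((c\<^sub>0 + c\<^sub>1) / M n)"
      using risk eventually_ge_at_top[of "1::nat"]
    proof eventually_elim
      case (elim n)
      then interpret iid_normal_posterior "horseshoe_plus (\<tau> n)" n by simp
      have Mn: "M n > 0" using M elim by simp
      define r where "r = M n * p n * ln (real n / p n)"
      have r: "r = M n * (p n * L n)" by (simp add: r_def L_def)
      have r0: "r > 0" using elim Mn by (simp add: r)
      show ?case
        unfolding r_def[symmetric]
      proof (rule SUP_least)
        fix \<theta>\<^sub>0 assume \<theta>: "\<theta>\<^sub>0 \<in> sparse_vectors n (p n)"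
        have "(\<integral>\<^sup>+x. emeasure (posterior n (iid_prior n (horseshoe_plus (\<tau> n))) x)
              {\<theta> \<in> euclidean_points n. sq_dist n \<theta> \<theta>\<^sub>0 > r} \<partial>sample_law n \<theta>\<^sub>0)
            \<le> (\<integral>\<^sup>+x. risk_sum \<theta>\<^sub>0 x / ennreal r \<partial>sample_law n \<theta>\<^sub>0)"
          by (intro nn_integral_mono posterior_tail r0)
        also have "\<dots> = Loss n \<theta>\<^sub>0 / ennreal r"
          unfolding Loss_def by (intro nn_integral_divide borel_measurable_risk_sum)
        also have "\<dots> \<le> ennreal ((c\<^sub>0 + c\<^sub>1) * (p n * L n)) / ennreal r"
          using elim \<theta> by (intro divide_right_mono_ennreal) auto
        also have "\<dots> = ennreal ((c\<^sub>0 + c\<^sub>1) / M n)"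
          using elim r0 c by (subst divide_ennreal) (auto simp: r)
        finally show "(\<integral>\<^sup>+x. emeasure (posterior n (iid_prior n (horseshoe_plus (\<tau> n))) x)
              {\<theta> \<in> euclidean_points n. sq_dist n \<theta> \<theta>\<^sub>0 > r} \<partial>sample_law n \<theta>\<^sub>0)
            \<le> ennreal ((c\<^sub>0 + c\<^sub>1) / M n)" .
      qed
    qed
    have "(\<lambda>n. (c\<^sub>0 + c\<^sub>1) / M n) \<longlonglongrightarrow> 0"
      by (rule tendsto_divide_0[OF tendsto_const filterlim_at_top_imp_at_infinity[OF M(2)]])
    then have "(\<lambda>n. ennreal ((c\<^sub>0 + c\<^sub>1) / M n)) \<longlonglongrightarrow> ennreal 0"
      by (rule tendsto_ennrealI)
    then have "(\<lambda>n. ennreal ((c\<^sub>0 + c\<^sub>1) / M n)) \<longlonglongrightarrow> 0" by simp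
    from tendsto_sandwich[OF _ bound tendsto_const this]
    show "?tail \<longlonglongrightarrow> 0" by simp
  next
    have "\<forall>\<^sub>F n in sequentially.
        (SUP \<theta>\<^sub>0\<in>sparse_vectors n (p n).
           \<integral>\<^sup>+x. ennreal (sq_dist n
                 (posterior_mean n (iid_prior n (horseshoe_plus (\<tau> n))) x) \<theta>\<^sub>0)
             \<partial>sample_law n \<theta>\<^sub>0)
        \<le> ennreal ((c\<^sub>0 + c\<^sub>1) * (p n * ln (real n / p n)))"
      using risk
    proof eventually_elim
      case (elim n)
      then interpret iid_normal_posterior "horseshoe_plus (\<tau> n)" n by simp
      show ?case
        unfolding L_def[symmetric]
      proof (rule SUP_least)
        fix \<theta>\<^sub>0 assume \<theta>: "\<theta>\<^sub>0 \<in> sparse_vectors n (p n)"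
        have "(\<integral>\<^sup>+x. ennreal (sq_dist n (posterior_mean n (iid_prior n (horseshoe_plus (\<tau> n))) x) \<theta>\<^sub>0) \<partial>sample_law n \<theta>\<^sub>0)
            \<le> Loss n \<theta>\<^sub>0"
          unfolding Loss_def by (intro nn_integral_mono posterior_mean_error)
        also have "\<dots> \<le> ennreal ((c\<^sub>0 + c\<^sub>1) * (p n * L n))"
          using elim \<theta> by auto
        finally show "(\<integral>\<^sup>+x. ennreal (sq_dist n (posterior_mean n (iid_prior n (horseshoe_plus (\<tau> n))) x) \<theta>\<^sub>0) \<partial>sample_law n \<theta>\<^sub>0)
            \<le> ennreal ((c\<^sub>0 + c\<^sub>1) * (p n * L n))" .
      qed
    qed
    then show "\<exists>C :: real. \<forall>\<^sub>F n in sequentially.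
        (SUP \<theta>\<^sub>0\<in>sparse_vectors n (p n).
           \<integral>\<^sup>+x. ennreal (sq_dist n
                 (posterior_mean n (iid_prior n (horseshoe_plus (\<tau> n))) x) \<theta>\<^sub>0)
             \<partial>sample_law n \<theta>\<^sub>0)
        \<le> ennreal (C * (p n * ln (real n / p n)))" by blast
  qed
qed

end
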